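(* Let $K$ be a field and let $G$ be a bipartite graph that comes from a poset with $n$ elements, $n\ge1$. Then $$2^n\le e(A(G))\le n!\sum_{l=0}^n\frac1{l!}.$$ The left equality holds if and only if the poset is a chain, and the right equality holds if and only if the poset is an antichain.
   Context: $V_n=\{x_1,\dots,x_n\}\cup\{y_1,\dots,y_n\}$. For a poset $P_n=\{p_1,\dots,p_n\}$, $G(P_n)$ is the bipartite graph on $V_n$ whose edges are all $\{x_i,y_j\}$ with $p_i\le p_j$. A bipartite graph $G$ on $V_n$ comes from a poset if there is a poset $P_n=\{p_1,\dots,p_n\}$ with $p_i\le p_j\Rightarrow i\le j$ such that, after relabelling the vertices, $G=G(P_n)$. Let $S=K[x_1,\dots,x_n,y_1,\dots,y_n]$. A $k$-vertex cover of $G$ ($k\in\mathbb N$, $0\in\mathbb N$) is a vector $c\in\mathbb N^{2n}$, indexed by the vertices, with $c(v)+c(w)\ge k$ for every edge $\{v,w\}$. The vertex cover algebra $A(G)$ is the subalgebra of $S[t]$ generated over $K$ by all monomials $x_1^{c_1}\cdots x_n^{c_n}y_1^{c_{n+1}}\cdots y_n^{c_{2n}}t^k$ with $c$ a $k$-vertex cover, $k\in\mathbb N$. It is known that $A(G)=\bigoplus_{k\ge0}I_G^kt^k$, where the cover ideal $I_G\subset S$ is minimally generated by the monomials $m_C=\prod_{v\in C}v$, $C$ a minimal vertex cover of $G$, and each such $C$ has exactly $n$ elements. $A(G)$ is a standard graded $K$-algebra by giving degree $1$ to each $x_i$, each $y_j$ and each $m_Ct$. Its Krull dimension is $2n+1$,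 and $e(A(G))$ denotes its multiplicity, i.e. $(2n)!$ times the leading coefficient of its Hilbert polynomial (equivalently $h(1)$, where $H_{A(G)}(z)=h(z)/(1-z)^{2n+1}$). *)

theory Defs
  imports Complex_Main "HOL-Library.Poly_Mapping" "HOL-Computational_Algebra.Polynomial"
begin

section \<open>Bipartite graphs on $V_n$ that come from a poset\<close>

datatype vertex = X nat | Y nat

definition V :: "nat \<Rightarrow> vertex set" where
  "V n = X ` {1..n} \<union> Y ` {1..n}"

text \<open>A graph on \<open>V n\<close> is given by its set of edges. The bipartition is not required to be
  the one into the \<open>X i\<close> and the \<open>Y i\<close>.\<close>

definition bipartite_graph :: "nat \<Rightarrow> vertex set set \<Rightarrow> bool" where
  "bipartite_graph n E \<longleftrightarrow>
     (\<exists>A B. A \<union> B = V n \<and> A \<inter> B = {} \<and> (\<forall>e\<in>E. \<exists>v\<in>A. \<exists>w\<in>B. e = {v, w}))"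

definition poset_graph :: "nat \<Rightarrow> (nat \<Rightarrow> 'a) \<Rightarrow> 'a rel \<Rightarrow> vertex set set" where
  "poset_graph n p r = {{X i, Y j} | i j. i \<in> {1..n} \<and> j \<in> {1..n} \<and> (p i, p j) \<in> r}"

text \<open>The poset is the set \<open>P\<close> with the (reflexive) order relation \<open>r\<close>, enumerated as
  \<open>p 1, \<dots>, p n\<close>; \<open>\<sigma>\<close> is the relabelling of the vertices.\<close>

definition comes_from_poset :: "nat \<Rightarrow> vertex set set \<Rightarrow> 'a set \<Rightarrow> 'a rel \<Rightarrow> bool" where
  "comes_from_poset n E P r \<longleftrightarrow> partial_order_on P r \<and>
     (\<exists>p \<sigma>. bij_betw p {1..n} P \<and>
            (\<forall>i\<in>{1..n}. \<forall>j\<in>{1..n}. (p i, p j) \<in> r \<longrightarrow> i \<le> j) \<and>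
            bij_betw \<sigma> (V n) (V n) \<and>
            (\<lambda>e. \<sigma> ` e) ` E = poset_graph n p r)"

definition antichain :: "'a set \<Rightarrow> 'a rel \<Rightarrow> bool" where
  "antichain P r \<longleftrightarrow> (\<forall>a\<in>P. \<forall>b\<in>P. (a, b) \<in> r \<longrightarrow> a = b)"


section \<open>Vertex covers\<close>

text \<open>An exponent vector in $\mathbb{N}^{2n}$ is a finitely supported function on the vertices
  whose support lies in \<open>V n\<close>.\<close>

definition vertex_cover_vector :: "nat \<Rightarrow> vertex set set \<Rightarrow> nat \<Rightarrow> (vertex \<Rightarrow>\<^sub>0 nat) \<Rightarrow> bool" where
  "vertex_cover_vector n E k c \<longleftrightarrow> Poly_Mapping.keys c \<subseteq> V n \<and>
     (\<forall>v w. {v, w} \<in> E \<longrightarrow> Poly_Mapping.lookup c v + Poly_Mapping.lookup c w \<ge> k)"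

definition vertex_cover :: "nat \<Rightarrow> vertex set set \<Rightarrow> vertex set \<Rightarrow> bool" where
  "vertex_cover n E C \<longleftrightarrow> C \<subseteq> V n \<and> (\<forall>e\<in>E. e \<inter> C \<noteq> {})"

definition minimal_vertex_cover :: "nat \<Rightarrow> vertex set set \<Rightarrow> vertex set \<Rightarrow> bool" where
  "minimal_vertex_cover n E C \<longleftrightarrow> vertex_cover n E C \<and> (\<forall>D. vertex_cover n E D \<longrightarrow> \<not> D \<subset> C)"


section \<open>The vertex cover algebra\<close>

text \<open>The type \<open>'k polyS\<close> is the polynomial ring over \<open>'k\<close> in all variables \<open>X i\<close>, \<open>Y i\<close>. It
  contains the ring $S$ in the variables from \<open>V n\<close>, and \<open>'k polyS poly\<close> contains $S[t]$; the
  algebras below only involve elements of $S[t]$.\<close>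

type_synonym 'k polyS = "(vertex \<Rightarrow>\<^sub>0 nat) \<Rightarrow>\<^sub>0 'k"

text \<open>The monomial $x^c t^k$.\<close>

definition mon :: "(vertex \<Rightarrow>\<^sub>0 nat) \<Rightarrow> nat \<Rightarrow> 'k::field polyS poly" where
  "mon c k = Polynomial.monom (Poly_Mapping.single c 1) k"

definition scaleK :: "'k::field \<Rightarrow> 'k polyS poly \<Rightarrow> 'k polyS poly" where
  "scaleK a f = Polynomial.smult (Poly_Mapping.single 0 a) f"

global_interpretation St: vector_space "scaleK :: 'k::field \<Rightarrow> 'k polyS poly \<Rightarrow> 'k polyS poly"
  by unfold_locales
    (simp_all add: scaleK_def smult_add_right smult_add_left single_add mult_single)

definition is_subalgebra :: "'k::field polyS poly set \<Rightarrow> bool" where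
  "is_subalgebra B \<longleftrightarrow> St.subspace B \<and> 1 \<in> B \<and> (\<forall>f\<in>B. \<forall>g\<in>B. f * g \<in> B)"

definition vertex_cover_algebra :: "nat \<Rightarrow> vertex set set \<Rightarrow> 'k::field polyS poly set" where
  "vertex_cover_algebra n E = is_subalgebra hull {mon c k | c k. vertex_cover_vector n E k c}"


section \<open>Grading and multiplicity\<close>

definition indicator_vector :: "vertex set \<Rightarrow> (vertex \<Rightarrow>\<^sub>0 nat)" where
  "indicator_vector C = (\<Sum>v\<in>C. Poly_Mapping.single v 1)"

text \<open>The elements $x_i$, $y_j$ and $m_C t$, which are given degree 1.\<close>

definition degree_one_generators :: "nat \<Rightarrow> vertex set set \<Rightarrow> 'k::field polyS poly set" where
  "degree_one_generators n E =
     {mon (Poly_Mapping.single v 1) 0 | v. v \<in> V n} \<union>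
     {mon (indicator_vector C) 1 | C. minimal_vertex_cover n E C}"

lemma lookup_indicator_vector:
  assumes "finite C"
  shows "Poly_Mapping.lookup (indicator_vector C) v = (if v \<in> C then 1 else 0)"
  using assms unfolding indicator_vector_def
  by (induction C) (auto simp: lookup_add lookup_single when_def)

lemma mon_mult: "mon c k * mon d l = mon (c + d) (k + l)"
  by (simp add: mon_def mult_monom mult_single)

lemma is_subalgebra_hull: "is_subalgebra (is_subalgebra hull B)"
  by (rule hull_in) (simp add: is_subalgebra_def St.subspace_Inter)

lemma finite_V: "finite (V n)"
  by (simp add: V_def)

lemma finite_vertex_cover: "vertex_cover n E C \<Longrightarrow> finite C"
  by (rule finite_subset[OF _ finite_V[of n]]) (simp add: vertex_cover_def)

lemma minimal_vertex_cover_subset: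
  assumes "vertex_cover n E D"
  obtains C where "minimal_vertex_cover n E C" "C \<subseteq> D"
proof -
  have "finite D"
    using assms by (rule finite_vertex_cover)
  then have "\<exists>C. minimal_vertex_cover n E C \<and> C \<subseteq> D" using assms
  proof (induction D rule: finite_psubset_induct)
    case (psubset D)
    show ?case
    proof (cases "minimal_vertex_cover n E D")
      case False
      then obtain D' where "vertex_cover n E D'" "D' \<subset> D"
        using psubset.prems unfolding minimal_vertex_cover_def by blast
      then obtain C where "minimal_vertex_cover n E C" "C \<subseteq> D'" using psubset.IH[of D'] by auto
      with \<open>D' \<subset> D\<close> show ?thesis by (intro exI[of _ C]) simp
    next
      case True
      then show ?thesis by (intro exI[of _ D]) simp
    qed
  qed
  then show thesis using that by (elim exE conjE)
qed

text \<open>The algebra \<open>A(G)\<close> is generated by the elements of degree 1.\<close>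

lemma vertex_cover_algebra_generators:
  assumes "bipartite_graph n E"
  shows "(vertex_cover_algebra n E :: 'k::field polyS poly set) =
           is_subalgebra hull (degree_one_generators n E)"
proof
  let ?H = "is_subalgebra hull (degree_one_generators n E :: 'k polyS poly set)"
  obtain A B where AB: "A \<union> B = V n" "A \<inter> B = {}" "\<forall>e\<in>E. \<exists>v\<in>A. \<exists>w\<in>B. e = {v, w}"
    using assms unfolding bipartite_graph_def by blast
  note subalg = is_subalgebra_hull[of "degree_one_generators n E :: 'k polyS poly set",
      THEN iffD1[OF is_subalgebra_def]]
  have one: "1 \<in> ?H" using subalg by simp
  have mult: "f * g \<in> ?H" if "f \<in> ?H" "g \<in> ?H" for f g using subalg that by simp
  have gen: "g \<in> ?H" if "g \<in> degree_one_generators n E" for g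
    by (rule subsetD[OF hull_subset that])
  have zero: "mon c 0 \<in> ?H" if "Poly_Mapping.keys c \<subseteq> V n" for c
    using that
  proof (induction "\<Sum>v\<in>V n. Poly_Mapping.lookup c v" arbitrary: c)
    case 0
    have "Poly_Mapping.lookup c v = 0" for v
    proof (cases "v \<in> V n")
      case True
      then show ?thesis using 0(1) finite_V[of n] by simp
    next
      case False
      then show ?thesis using 0(2) by (meson in_keys_iff subsetD)
    qed
    then have "c = 0" by (intro poly_mapping_eqI) simp
    then show ?case using one by (simp add: mon_def)
  next
    case (Suc m)
    from Suc.hyps(2) have "(\<Sum>v\<in>V n. Poly_Mapping.lookup c v) \<noteq> 0" by linarith
    then obtain v where v: "v \<in> V n" "Poly_Mapping.lookup c v \<noteq> 0"
      by (rule sum.not_neutral_contains_not_neutral)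
    define d where "d = c - Poly_Mapping.single v 1"
    have c: "c = Poly_Mapping.single v 1 + d"
      by (rule poly_mapping_eqI)
        (use v in \<open>auto simp: d_def lookup_add lookup_minus lookup_single when_def\<close>)
    have "Suc m = 1 + (\<Sum>v\<in>V n. Poly_Mapping.lookup d v)"
      unfolding Suc.hyps(2) by (subst c) 
        (use v finite_V in \<open>simp add: lookup_add lookup_single sum.distrib when_def\<close>)
    moreover have "Poly_Mapping.keys d \<subseteq> V n"
      using Suc.prems v by (auto simp: d_def in_keys_iff lookup_minus subset_iff)
    ultimately have "mon d 0 \<in> ?H" using Suc.hyps(1) by simp
    moreover have "mon (Poly_Mapping.single v 1) 0 \<in> ?H"
      by (rule gen) (use v in \<open>auto simp: degree_one_generators_def\<close>)
    ultimately have "mon (Poly_Mapping.single v 1) 0 * mon d 0 \<in> ?H" by (rule mult[rotated])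
    then show ?case unfolding mon_mult c[symmetric] by simp
  qed
  have all: "mon c k \<in> ?H" if "vertex_cover_vector n E k c" for c k
    using that
  proof (induction k arbitrary: c)
    case 0
    then show ?case using zero unfolding vertex_cover_vector_def by blast
  next
    case (Suc k)
    let ?l = "Poly_Mapping.lookup c"
    define D where "D = {v \<in> A. ?l v \<ge> 1} \<union> {w \<in> B. ?l w \<ge> Suc k}"
    have cov: "?l v + ?l w \<ge> Suc k" if "{v, w} \<in> E" for v w
      using Suc.prems that unfolding vertex_cover_vector_def by blast
    have "vertex_cover n E D"
      unfolding vertex_cover_def
    proof (intro conjI ballI)
      show "D \<subseteq> V n" using AB(1) by (auto simp: D_def)
      fix e assume "e \<in> E"
      then obtain v w where e: "v \<in> A" "w \<in> B" "e = {v, w}" using AB(3) by blast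
      with \<open>e \<in> E\<close> cov[of v w] have "?l v \<ge> 1 \<or> ?l w \<ge> Suc k" by auto
      with e show "e \<inter> D \<noteq> {}" by (auto simp: D_def)
    qed
    then obtain C where C: "minimal_vertex_cover n E C" "C \<subseteq> D"
      by (rule minimal_vertex_cover_subset)
    have fC: "finite C"
      using C(1) by (intro finite_vertex_cover[of n E]) (simp add: minimal_vertex_cover_def)
    note ind = lookup_indicator_vector[OF fC]
    define d where "d = c - indicator_vector C"
    have ge: "?l v \<ge> 1" if "v \<in> C" for v using that C(2) by (auto simp: D_def)
    have c: "c = indicator_vector C + d"
      by (rule poly_mapping_eqI) (use ge in \<open>auto simp: d_def lookup_add lookup_minus ind\<close>)
    have "vertex_cover_vector n E k d"
      unfolding vertex_cover_vector_def
    proof (intro conjI allI impI)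
      show "Poly_Mapping.keys d \<subseteq> V n"
        using Suc.prems by (auto simp: vertex_cover_vector_def d_def in_keys_iff lookup_minus subset_iff)
      fix v w assume vw: "{v, w} \<in> E"
      have *: "Poly_Mapping.lookup d v + Poly_Mapping.lookup d w \<ge> k"
        if "v \<in> A" "w \<in> B" "{v, w} \<in> E" for v w
      proof (cases "v \<in> C \<and> w \<in> C")
        case True
        then have "?l w \<ge> Suc k" using C(2) that AB(2) by (auto simp: D_def)
        then show ?thesis using True by (simp add: d_def lookup_minus ind)
      next
        case False
        then show ?thesis using cov[OF that(3)] by (auto simp: d_def lookup_minus ind)
      qed
      obtain v' w' where vw': "v' \<in> A" "w' \<in> B" "{v, w} = {v', w'}"
        using bspec[OF AB(3) vw] by (elim bexE)
      then have "Poly_Mapping.lookup d v' + Poly_Mapping.lookup d w' \<ge> k"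
        using vw by (intro *) simp_all
      moreover have "(v = v' \<and> w = w') \<or> (v = w' \<and> w = v')"
        using vw'(3) by (simp add: doubleton_eq_iff)
      ultimately show "Poly_Mapping.lookup d v + Poly_Mapping.lookup d w \<ge> k"
        by (elim disjE conjE) simp_all
    qed
    then have "mon d k \<in> ?H" by (rule Suc.IH)
    moreover have "mon (indicator_vector C) 1 \<in> ?H"
      by (rule gen) (use C in \<open>auto simp: degree_one_generators_def\<close>)
    ultimately have "mon (indicator_vector C) 1 * mon d k \<in> ?H" by (rule mult[rotated])
    then show ?case unfolding mon_mult c[symmetric] by simp
  qed
  show "vertex_cover_algebra n E \<subseteq> ?H"
    unfolding vertex_cover_algebra_def
    by (intro hull_minimal subsetI is_subalgebra_hull) (use all in blast)
  show "?H \<subseteq> vertex_cover_algebra n E"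
    unfolding vertex_cover_algebra_def
  proof (rule hull_mono, rule subsetI)
    fix g :: "'k polyS poly"
    assume "g \<in> degree_one_generators n E"
    then consider v where "v \<in> V n" "g = mon (Poly_Mapping.single v 1) 0"
      | C where "minimal_vertex_cover n E C" "g = mon (indicator_vector C) 1"
      by (auto simp: degree_one_generators_def)
    then show "g \<in> {mon c k | c k. vertex_cover_vector n E k c}"
    proof cases
      case 1
      then have "vertex_cover_vector n E 0 (Poly_Mapping.single v 1)"
        by (auto simp: vertex_cover_vector_def)
      with 1 show ?thesis by blast
    next
      case 2
      then have C: "C \<subseteq> V n" "\<forall>e\<in>E. e \<inter> C \<noteq> {}"
        by (auto simp: minimal_vertex_cover_def vertex_cover_def)
      have fC: "finite C" using C(1) finite_V by (rule finite_subset)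
      have "vertex_cover_vector n E 1 (indicator_vector C)"
        unfolding vertex_cover_vector_def
      proof (intro conjI allI impI)
        show "Poly_Mapping.keys (indicator_vector C) \<subseteq> V n"
          using C(1) by (auto simp: in_keys_iff lookup_indicator_vector[OF fC] split: if_splits)
        fix v w assume "{v, w} \<in> E"
        with C(2) have "{v, w} \<inter> C \<noteq> {}" by (rule bspec)
        then have "v \<in> C \<or> w \<in> C" by auto
        then show "1 \<le> Poly_Mapping.lookup (indicator_vector C) v + Poly_Mapping.lookup (indicator_vector C) w"
          by (auto simp: lookup_indicator_vector[OF fC])
      qed
      with 2 show ?thesis by blast
    qed
  qed
qed

text \<open>The homogeneous elements of degree \<open>d\<close> of an algebra \<open>A\<close> that is standard graded by giving
  degree 1 to the elements of \<open>B\<close>: the linear combinations of products of \<open>d\<close> elements of \<open>B\<close>.\<close>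

definition homogeneous_part ::
    "'k::field polyS poly set \<Rightarrow> 'k polyS poly set \<Rightarrow> nat \<Rightarrow> 'k polyS poly set" where
  "homogeneous_part A B d = A \<inter> St.span {\<Prod>i<d. g i | g. \<forall>i<d. g i \<in> B}"

definition hilbert_function ::
    "'k::field polyS poly set \<Rightarrow> 'k polyS poly set \<Rightarrow> nat \<Rightarrow> nat" where
  "hilbert_function A B d = St.dim (homogeneous_part A B d)"

definition hilbert_polynomial ::
    "'k::field polyS poly set \<Rightarrow> 'k polyS poly set \<Rightarrow> real poly" where
  "hilbert_polynomial A B =
     (THE q. \<forall>\<^sub>F d in sequentially. real (hilbert_function A B d) = poly q (real d))"

text \<open>The field is passed as a type argument. The Krull dimension of the algebra is $2n+1$, so
  its Hilbert polynomial has degree $2n$.\<close>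

definition multiplicity_vca :: "'k::field itself \<Rightarrow> nat \<Rightarrow> vertex set set \<Rightarrow> real" where
  "multiplicity_vca _ n E = fact (2 * n) *
     lead_coeff (hilbert_polynomial
       (vertex_cover_algebra n E :: 'k polyS poly set) (degree_one_generators n E))"

end

theory Submission
  imports Defs
begin

text \<open>The monomials of degree \<open>d\<close> in $A(G)$ correspond to the pairs of some \<open>k\<close> and a \<open>k\<close>-cover
  \<open>c\<close> with \<open>|c| + k = d + n k\<close>. The smallest values that such a \<open>c\<close> can take on the $x_i$, given
  those on the $y_j$, form an order reversing map \<open>w\<close> from the poset to \<open>{0..k}\<close>. It is determined
  by its restriction to the set \<open>S\<close> of the \<open>i\<close> at which it jumps (\<open>w i > 0\<close>, and \<open>w j < w i\<close> for
  all \<open>j > i\<close> in the poset), which is a strictly order reversing map to \<open>{1..k}\<close>; the excess of \<open>c\<close>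
  over \<open>w\<close> consists of \<open>2n - |S|\<close> free natural numbers. The number of strict maps on \<open>S\<close> is a polynomial in \<open>k\<close> with
  leading term \<open>e(S) k^|S| / |S|!\<close>, where \<open>e(S)\<close> is the number of linear extensions of \<open>S\<close>, and
  each free number amounts to a partial summation. So the multiplicity is the sum of \<open>e(S)\<close> over
  all subsets \<open>S\<close> of the poset, and \<open>1 \<le> e(S) \<le> |S|!\<close> gives the bounds and the cases of equality.\<close>

section \<open>Numerical polynomials\<close>

text \<open>In the binomial basis the coefficient \<open>L\<close> of degree \<open>D\<close> (\<open>D!\<close> times the ordinary leading
  coefficient) is invariant under summation.\<close>

definition binomial_form :: "nat \<Rightarrow> real \<Rightarrow> (nat \<Rightarrow> real) \<Rightarrow> bool" where
  "binomial_form D L F \<longleftrightarrow> (\<exists>a. a D = L \<and> (\<forall>d. F d = (\<Sum>j\<le>D. a j * real (d choose j))))"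

lemma binomial_formI:
  assumes "\<And>d. F d = (\<Sum>j\<le>D. a j * real (d choose j))" "a D = L"
  shows "binomial_form D L F"
  using assms unfolding binomial_form_def by blast

lemma binomial_form_const: "binomial_form 0 c (\<lambda>_. c)"
  by (rule binomial_formI[where a = "\<lambda>_. c"]) auto

lemma binomial_form_zero: "binomial_form D 0 (\<lambda>_. 0)"
  by (rule binomial_formI[where a = "\<lambda>_. 0"]) auto

lemma binomial_form_add:
  assumes "binomial_form D L F" "binomial_form D M G"
  shows "binomial_form D (L + M) (\<lambda>d. F d + G d)"
proof -
  obtain a where a: "\<And>d. F d = (\<Sum>j\<le>D. a j * real (d choose j))" "a D = L"
    using assms(1) unfolding binomial_form_def by blast
  obtain b where b: "\<And>d. G d = (\<Sum>j\<le>D. b j * real (d choose j))" "b D = M"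
    using assms(2) unfolding binomial_form_def by blast
  show ?thesis
    by (rule binomial_formI[where a = "\<lambda>j. a j + b j"])
       (simp_all add: a b sum.distrib ring_distribs)
qed

lemma binomial_form_sum:
  assumes "\<And>x. x \<in> A \<Longrightarrow> binomial_form D (L x) (F x)"
  shows "binomial_form D (\<Sum>x\<in>A. L x) (\<lambda>d. \<Sum>x\<in>A. F x d)"
  using assms
  by (induction A rule: infinite_finite_induct) (auto intro: binomial_form_zero binomial_form_add)

text \<open>Padding with zero coefficients. It lets terms of lower degree be added to a form without
  changing its top coefficient.\<close>

lemma binomial_form_higher:
  assumes "binomial_form D L F" "D < D'"
  shows "binomial_form D' 0 F"
proof -
  obtain a where a: "\<And>d. F d = (\<Sum>j\<le>D. a j * real (d choose j))" "a D = L"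
    using assms(1) unfolding binomial_form_def by blast
  show ?thesis
  proof (rule binomial_formI[where a = "\<lambda>j. if j \<le> D then a j else 0"])
    fix d
    have "(\<Sum>j\<le>D'. (if j \<le> D then a j else 0) * real (d choose j)) =
          (\<Sum>j\<le>D. (if j \<le> D then a j else 0) * real (d choose j))"
      using assms(2) by (intro sum.mono_neutral_right) auto
    then show "F d = (\<Sum>j\<le>D'. (if j \<le> D then a j else 0) * real (d choose j))"
      by (simp add: a)
  qed (use assms in auto)
qed

text \<open>By Pascal's rule \<open>d choose Suc j\<close> is a discrete antiderivative of
  \<open>d choose j\<close>. So the coefficients move up by one place, and \<open>F 0\<close> fills
  the constant place.\<close>

lemma binomial_form_difference:
  assumes "binomial_form D L (\<lambda>k. F (Suc k) - F k)"
  shows "binomial_form (Suc D) L F"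
proof -
  obtain a where a: "\<And>k. F (Suc k) - F k = (\<Sum>j\<le>D. a j * real (k choose j))" "a D = L"
    using assms unfolding binomial_form_def by blast
  show ?thesis
  proof (rule binomial_formI[where a = "case_nat (F 0) a"])
    fix d
    have "F d = F 0 + (\<Sum>j\<le>D. a j * real (d choose Suc j))"
    proof (induction d)
      case (Suc d)
      have "F (Suc d) = F d + (\<Sum>j\<le>D. a j * real (d choose j))"
        using a(1)[of d] by simp
      then show ?case by (simp add: Suc sum.distrib ring_distribs)
    qed simp
    then show "F d = (\<Sum>j\<le>Suc D. case_nat (F 0) a j * real (d choose j))"
      by (subst sum.atMost_Suc_shift) simp
  qed (simp add: a)
qed

text \<open>The sum over \<open>k < d\<close> has the difference \<open>F\<close>. The remaining
  summand \<open>F d\<close> is of lower degree and leaves \<open>L\<close> unchanged.\<close>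

lemma binomial_form_partial_sum:
  assumes "binomial_form D L F"
  shows "binomial_form (Suc D) L (\<lambda>d. \<Sum>k\<le>d. F k)"
proof -
  have "binomial_form (Suc D) L (\<lambda>d. \<Sum>k<d. F k)"
    by (rule binomial_form_difference) (use assms in simp)
  from binomial_form_add[OF this binomial_form_higher[OF assms, of "Suc D"]]
  show ?thesis by (simp add: lessThan_Suc_atMost[symmetric])
qed

lemma poly_binomial:
  obtains b :: "real poly" where "\<And>d. poly b (real d) = real (d choose j)"
    "degree b = j" "lead_coeff b = 1 / fact j"
proof -
  \<comment> \<open>The falling factorial divided by \<open>fact j\<close>.\<close>
  define b :: "real poly" where "b = smult (1 / fact j) (\<Prod>i<j. [:- real i, 1:])"
  have "lead_coeff (\<Prod>i<j. [:- real i, 1:]) = 1"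
    by (simp add: lead_coeff_prod)
  moreover have "degree (\<Prod>i<j. [:- real i, 1:]) = j"
    by (subst degree_prod_eq_sum_degree) auto
  moreover have "poly b (real d) = real (d choose j)" for d
    by (simp add: b_def poly_prod binomial_gbinomial gbinomial_prod_rev atLeast0LessThan
          flip: of_nat_diff)
  ultimately show thesis by (intro that[of b]) (auto simp: b_def)
qed

text \<open>Only the summand \<open>j = D\<close> reaches the exponent \<open>D\<close>, and
  \<open>L\<close> being nonzero makes \<open>D\<close> the exact degree.\<close>

lemma poly_of_binomial_form:
  assumes "binomial_form D L F" "L \<noteq> 0"
  obtains q :: "real poly" where "\<And>d. poly q (real d) = F d" "lead_coeff q = L / fact D"
proof -
  obtain a where a: "\<And>d. F d = (\<Sum>j\<le>D. a j * real (d choose j))" "a D = L"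
    using assms(1) unfolding binomial_form_def by blast
  have "\<exists>b :: real poly. (\<forall>d. poly b (real d) = real (d choose j)) \<and>
      degree b = j \<and> lead_coeff b = 1 / fact j" for j
    using poly_binomial[of j] by metis
  then obtain b :: "nat \<Rightarrow> real poly" where b: "\<And>j d. poly (b j) (real d) = real (d choose j)"
      "\<And>j. degree (b j) = j" "\<And>j. coeff (b j) j = 1 / fact j"
    by metis
  define q where "q = (\<Sum>j\<le>D. smult (a j) (b j))"
  have "coeff (b j) D = 0" if "j < D" for j
    using that b(2) by (simp add: coeff_eq_0)
  then have "coeff q D = (\<Sum>j\<le>D. if j = D then a D / fact D else 0)"
    unfolding q_def coeff_sum by (intro sum.cong) (auto simp: b)
  then have coeff: "coeff q D = L / fact D" by (simp add: a)
  have "degree q \<le> D"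
    unfolding q_def by (intro degree_sum_le) (auto intro: order.trans[OF degree_smult_le] simp: b)
  moreover have "degree q \<ge> D" by (rule le_degree) (use coeff assms in simp)
  ultimately have "lead_coeff q = L / fact D" using coeff by simp
  moreover have "poly q (real d) = F d" for d by (simp add: q_def poly_sum b a)
  ultimately show thesis by (rule that[rotated])
qed

lemma poly_eqI_eventually:
  fixes p q :: "real poly"
  assumes "\<forall>\<^sub>F d in sequentially. poly p (real d) = poly q (real d)"
  shows "p = q"
proof (rule ccontr)
  assume "p \<noteq> q"
  then have "finite {x. poly (p - q) x = 0}" by (intro poly_roots_finite) simp
  then have "finite (real -` {x. poly (p - q) x = 0})" by (rule finite_vimageI) simp
  moreover obtain N where "\<And>d. d \<ge> N \<Longrightarrow> poly p (real d) = poly q (real d)"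
    using assms unfolding eventually_sequentially by blast
  then have "{N..} \<subseteq> real -` {x. poly (p - q) x = 0}" by auto
  ultimately have "finite {N..}" by (rule finite_subset[rotated])
  then show False using infinite_Ici by blast
qed

text \<open>A real polynomial is determined by its values at all large integers, so the definite
  description picks the polynomial that belongs to the binomial form.\<close>

lemma lead_coeff_hilbert_polynomial:
  assumes "binomial_form D L (\<lambda>d. real (hilbert_function A B d))" "L \<noteq> 0"
  shows "lead_coeff (hilbert_polynomial A B) = L / fact D"
proof -
  obtain q :: "real poly" where q: "\<And>d. poly q (real d) = real (hilbert_function A B d)"
    "lead_coeff q = L / fact D"
    using poly_of_binomial_form[OF assms] by blast
  have "hilbert_polynomial A B = q"
    unfolding hilbert_polynomial_def
  proof (rule the_equality)
    show "p = q" if "\<forall>\<^sub>F d in sequentially. real (hilbert_function A B d) = poly p (real d)" for p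
      by (rule poly_eqI_eventually) (use that in \<open>simp add: q eq_commute\<close>)
  qed (simp add: q)
  then show ?thesis by (simp add: q)
qed

text \<open>Each index in \<open>J\<close> carries one free natural number. Adding an index replaces
  the count by its partial sums, which raises the degree by one and keeps \<open>L\<close>.\<close>

lemma binomial_form_convolution:
  fixes C :: "nat \<Rightarrow> 'b set" and J :: "'c set"
  assumes "finite J" "\<And>k. finite (C k)" "binomial_form D L (\<lambda>k. real (card (C k)))"
  defines "T \<equiv> \<lambda>J d. {(v, g :: 'c \<Rightarrow> nat, k). v \<in> C k \<and> (\<forall>u. u \<notin> J \<longrightarrow> g u = 0) \<and> sum g J + k = d}"
  shows "(\<forall>d. finite (T J d)) \<and> binomial_form (D + card J) L (\<lambda>d. real (card (T J d)))"
  using assms(1)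
proof (induction J rule: finite_induct)
  case empty
  have "T {} d = (\<lambda>v. (v, \<lambda>_. 0, d)) ` C d" for d
    by (auto simp: T_def)
  moreover have "card ((\<lambda>v. (v, \<lambda>_ :: 'c. 0 :: nat, d)) ` C d) = card (C d)" for d
    by (rule card_image) (auto simp: inj_on_def)
  ultimately show ?case using assms(2,3) by simp
next
  case (insert j J)
  let ?f = "\<lambda>a (v, g :: 'c \<Rightarrow> nat, k :: nat). (v :: 'b, g(j := a), k)"
  have sum_upd: "sum (g(j := a)) J = sum g J" for g :: "'c \<Rightarrow> nat" and a
    using insert.hyps by (intro sum.cong) auto
  \<comment> \<open>Split by the value \<open>a\<close> of \<open>g\<close> at \<open>j\<close>.
    Resetting that value to 0 leaves an element for \<open>J\<close> with total
    \<open>d - a\<close>.\<close>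
  have T: "T (insert j J) d = (\<Union>a\<le>d. ?f a ` T J (d - a))" for d
  proof (intro subset_antisym subsetI)
    fix x assume x: "x \<in> T (insert j J) d"
    obtain v g k where x_eq: "x = (v, g, k)" by (cases x)
    have "(v, g(j := 0), k) \<in> T J (d - g j)" "g j \<le> d"
      using x insert.hyps unfolding x_eq by (auto simp: T_def intro!: sum.cong)
    moreover have "x = ?f (g j) (v, g(j := 0), k)" by (simp add: x_eq)
    ultimately show "x \<in> (\<Union>a\<le>d. ?f a ` T J (d - a))" by blast
  next
    fix x assume "x \<in> (\<Union>a\<le>d. ?f a ` T J (d - a))"
    then obtain a v g k where "a \<le> d" "(v, g, k) \<in> T J (d - a)" "x = (v, g(j := a), k)" by auto
    then show "x \<in> T (insert j J) d"
      using insert.hyps sum_upd[of g a] by (auto simp: T_def)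
  qed
  have fin: "finite (T J d)" for d using insert.IH by blast
  \<comment> \<open>Elements of \<open>T J e\<close> vanish at \<open>j\<close>, so overwriting that
    value loses nothing.\<close>
  have "card (?f a ` T J e) = card (T J e)" for a e
  proof (rule card_image, rule inj_onI)
    fix x y assume *: "x \<in> T J e" "y \<in> T J e" "?f a x = ?f a y"
    obtain v g k v' g' k' where xy: "x = (v, g, k)" "y = (v', g', k')" by (metis prod_cases3)
    have "g u = g' u" for u
      using * insert.hyps by (cases "u = j") (auto simp: xy T_def dest: fun_cong[of _ _ u])
    then have "g = g'" by (rule ext)
    then show "x = y" using *(3) by (simp add: xy)
  qed
  moreover have "card (T (insert j J) d) = (\<Sum>a\<le>d. card (?f a ` T J (d - a)))" for d
    unfolding T
  proof (rule card_UN_disjoint)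
    show "\<forall>a\<in>{..d}. \<forall>b\<in>{..d}. a \<noteq> b \<longrightarrow> ?f a ` T J (d - a) \<inter> ?f b ` T J (d - b) = {}"
      by (auto dest: fun_upd_eqD)
  qed (use fin in auto)
  moreover have "(\<Sum>a\<le>d. card (T J (d - a))) = (\<Sum>e\<le>d. card (T J e))" for d
    by (rule sum.reindex_bij_witness[of _ "\<lambda>e. d - e" "\<lambda>e. d - e"]) auto
  ultimately have "card (T (insert j J) d) = (\<Sum>e\<le>d. card (T J e))" for d by simp
  then have "binomial_form (Suc (D + card J)) L (\<lambda>d. real (card (T (insert j J) d)))"
    using binomial_form_partial_sum[OF conjunct2[OF insert.IH]] by simp
  moreover have "finite (T (insert j J) d)" for d unfolding T using fin by auto
  ultimately show ?case using insert.hyps by simp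
qed


section \<open>Monomial bases\<close>

lemma coeff_mon: "Poly_Mapping.lookup (coeff (mon c k :: 'k::field polyS poly) l) d = (if c = d \<and> k = l then 1 else 0)"
  by (auto simp: mon_def coeff_monom lookup_single when_def)

lemma coeff_scaleK:
  "Poly_Mapping.lookup (coeff (scaleK a f) l) d = a * Poly_Mapping.lookup (coeff f l) d"
  by (simp add: scaleK_def mult_map_scale_conv_mult[symmetric] map.rep_eq when_def)

lemma coeff_span_mon:
  assumes "f \<in> St.span (case_prod mon ` M :: 'k::field polyS poly set)" "(c, k) \<notin> M"
  shows "Poly_Mapping.lookup (coeff f k) c = 0"
  using assms(1)
proof (induction rule: St.span_induct_alt)
  case (step a f g)
  then show ?case using assms(2) by (auto simp: coeff_scaleK lookup_add coeff_mon split: if_splits)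
qed simp

text \<open>The coefficient at an exponent outside \<open>M\<close> vanishes on the whole span. This
  yields linear independence of monomials, and it later turns membership in a span into membership
  in the spanning set.\<close>

lemma mon_in_span_iff:
  "(mon c k :: 'k::field polyS poly) \<in> St.span (case_prod mon ` M) \<longleftrightarrow> (c, k) \<in> M"
proof
  assume "mon c k \<in> St.span (case_prod mon ` M :: 'k polyS poly set)"
  from coeff_span_mon[OF this, of c k] show "(c, k) \<in> M" by (auto simp: coeff_mon)
next
  assume "(c, k) \<in> M"
  then show "mon c k \<in> St.span (case_prod mon ` M :: 'k polyS poly set)"
    by (intro St.span_base) (auto intro: rev_image_eqI)
qed

lemma mon_eq_iff: "(mon c k :: 'k::field polyS poly) = mon d l \<longleftrightarrow> c = d \<and> k = l"
  using coeff_mon[of c k l d, where 'k = 'k] coeff_mon[of d l l d, where 'k = 'k]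
  by (auto split: if_splits)

lemma dim_span_mon: "St.dim (St.span (case_prod mon ` M :: 'k::field polyS poly set)) = card M"
proof -
  have "\<not> St.dependent (case_prod mon ` M :: 'k polyS poly set)"
    unfolding St.dependent_def
  proof clarsimp
    fix c k
    assume *: "(c, k) \<in> M" "mon c k \<in> St.span (case_prod mon ` M - {mon c k :: 'k polyS poly})"
    have "case_prod mon ` M - {mon c k :: 'k polyS poly} = case_prod mon ` (M - {(c, k)})"
      by (auto simp: mon_eq_iff)
    then show False using * mon_in_span_iff[of c k "M - {(c, k)}", where 'k = 'k] by simp
  qed
  then have "St.dim (St.span (case_prod mon ` M :: 'k polyS poly set)) =
      card (case_prod mon ` M :: 'k polyS poly set)"
    by (simp add: St.dim_span St.dim_eq_card_independent)
  also have "\<dots> = card M" by (intro card_image) (auto simp: inj_on_def mon_eq_iff)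
  finally show ?thesis .
qed

section \<open>Products of generators and the graded pieces of the algebra\<close>

lemma mult_scaleK:
  "scaleK a f * g = scaleK a (f * g)" "f * scaleK a g = scaleK a (f * g)"
  by (simp_all add: scaleK_def)

lemma span_mult_closed:
  fixes Q :: "'k::field polyS poly set"
  assumes "\<And>f g. f \<in> Q \<Longrightarrow> g \<in> Q \<Longrightarrow> f * g \<in> Q" "f \<in> St.span Q" "g \<in> St.span Q"
  shows "f * g \<in> St.span Q"
  using assms(2)
proof (induction rule: St.span_induct_alt)
  case base
  then show ?case by (simp add: St.span_zero)
next
  case (step a f h)
  have "f * g \<in> St.span Q" using assms(3)
  proof (induction rule: St.span_induct_alt)
    case base
    then show ?case by (simp add: St.span_zero)
  next
    case (step b g h)
    with \<open>f \<in> Q\<close> show ?case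
      by (simp add: ring_distribs mult_scaleK St.span_add St.span_scale St.span_base assms(1))
  qed
  with step show ?case
    by (simp add: ring_distribs mult_scaleK St.span_add St.span_scale)
qed

text \<open>The exponents of the monomials of degree \<open>d\<close>: if \<open>m\<close> generators are variables and \<open>k\<close> are
  of the form $m_C t$, then \<open>d = m + k\<close>, while the exponents in $S$ add up to \<open>m + n k\<close>.\<close>

definition cover_exponents :: "nat \<Rightarrow> vertex set set \<Rightarrow> nat \<Rightarrow> ((vertex \<Rightarrow>\<^sub>0 nat) \<times> nat) set" where
  "cover_exponents n E d = {(c, k). vertex_cover_vector n E k c \<and>
     (\<Sum>v\<in>V n. Poly_Mapping.lookup c v) + k = d + n * k}"

text \<open>The spanning set that occurs in \<open>homogeneous_part\<close>, isolated for induction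
  on \<open>d\<close>.\<close>

definition products :: "'a::comm_monoid_mult set \<Rightarrow> nat \<Rightarrow> 'a set" where
  "products B d = {\<Prod>i<d. g i | g. \<forall>i<d. g i \<in> B}"

lemma products_0: "products B 0 = {1}"
  by (auto simp: products_def)

lemma products_Suc: "f \<in> products B (Suc d) \<longleftrightarrow> (\<exists>g\<in>products B d. \<exists>h\<in>B. f = g * h)"
proof
  assume "\<exists>g\<in>products B d. \<exists>h\<in>B. f = g * h"
  then obtain u h where "\<forall>i<d. u i \<in> B" "h \<in> B" "f = (\<Prod>i<d. u i) * h"
    by (auto simp: products_def)
  then show "f \<in> products B (Suc d)" unfolding products_def
    by (intro CollectI exI[of _ "u(d := h)"]) auto
next
  assume "f \<in> products B (Suc d)"
  then obtain u where "\<forall>i<Suc d. u i \<in> B" "f = (\<Prod>i<d. u i) * u d"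
    by (auto simp: products_def)
  then show "\<exists>g\<in>products B d. \<exists>h\<in>B. f = g * h"
    unfolding products_def by (intro bexI[of _ "\<Prod>i<d. u i"] bexI[of _ "u d"]) auto
qed

lemma products_mult:
  assumes "f \<in> products B d" "g \<in> products B e"
  shows "f * g \<in> products B (d + e)"
  using assms(2)
proof (induction e arbitrary: g)
  case (Suc e)
  then show ?case by (fastforce simp: products_Suc mult.assoc[symmetric])
qed (use assms(1) in \<open>simp add: products_0\<close>)

lemma vertex_cover_vector_add:
  "vertex_cover_vector n E k c \<Longrightarrow> vertex_cover_vector n E l d \<Longrightarrow>
   vertex_cover_vector n E (k + l) (c + d)"
proof -
  assume *: "vertex_cover_vector n E k c" "vertex_cover_vector n E l d"
  have "k + l \<le> Poly_Mapping.lookup (c + d) v + Poly_Mapping.lookup (c + d) w"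
    if "{v, w} \<in> E" for v w
  proof -
    have "k \<le> Poly_Mapping.lookup c v + Poly_Mapping.lookup c w"
      and "l \<le> Poly_Mapping.lookup d v + Poly_Mapping.lookup d w"
      using * that unfolding vertex_cover_vector_def by blast+
    then show ?thesis by (simp add: lookup_add)
  qed
  then show ?thesis
    using * keys_add[of c d] unfolding vertex_cover_vector_def by blast
qed

lemma cover_exponents_add:
  "(c, k) \<in> cover_exponents n E d \<Longrightarrow> (c', k') \<in> cover_exponents n E d' \<Longrightarrow>
   (c + c', k + k') \<in> cover_exponents n E (d + d')"
  by (auto simp: cover_exponents_def vertex_cover_vector_add lookup_add sum.distrib algebra_simps)

text \<open>For a variable the degree equation reads \<open>1 + 0 = 1 + n * 0\<close>. For a minimal
  cover it reads \<open>n + 1 = 1 + n * 1\<close>, which is where the size \<open>n\<close>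
  enters.\<close>

lemma degree_one_exponents:
  assumes "\<And>C. minimal_vertex_cover n E C \<Longrightarrow> card C = n" "f \<in> degree_one_generators n E"
  obtains c k where "f = mon c k" "(c, k) \<in> cover_exponents n E 1"
proof -
  consider v where "v \<in> V n" "f = mon (Poly_Mapping.single v 1) 0"
    | C where "minimal_vertex_cover n E C" "f = mon (indicator_vector C) 1"
    using assms(2) by (auto simp: degree_one_generators_def)
  then show thesis
  proof cases
    case 1
    then have "(Poly_Mapping.single v 1, 0) \<in> cover_exponents n E 1"
      by (auto simp: cover_exponents_def vertex_cover_vector_def lookup_single when_def finite_V)
    with 1 show thesis by (intro that)
  next
    case 2
    then have C: "C \<subseteq> V n" "\<forall>e\<in>E. e \<inter> C \<noteq> {}"
      by (auto simp: minimal_vertex_cover_def vertex_cover_def)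
    have fC: "finite C" using C(1) finite_V by (rule finite_subset)
    have "vertex_cover_vector n E 1 (indicator_vector C)"
      unfolding vertex_cover_vector_def
    proof (intro conjI allI impI)
      show "Poly_Mapping.keys (indicator_vector C) \<subseteq> V n"
        using C(1) by (auto simp: in_keys_iff lookup_indicator_vector[OF fC] split: if_splits)
      show "1 \<le> Poly_Mapping.lookup (indicator_vector C) v + Poly_Mapping.lookup (indicator_vector C) w"
        if "{v, w} \<in> E" for v w
        using bspec[OF C(2) that] by (auto simp: lookup_indicator_vector[OF fC])
    qed
    moreover have "(\<Sum>v\<in>V n. Poly_Mapping.lookup (indicator_vector C) v) = n"
      using assms(1)[OF 2(1)] C(1)
      by (simp add: lookup_indicator_vector[OF fC] finite_V Int_absorb1 flip: sum.inter_restrict)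
    ultimately show thesis by (intro that[OF 2(2)]) (simp add: cover_exponents_def)
  qed
qed

text \<open>One inclusion follows by multiplying exponents. For the other, the span of all products
  of generators is a subalgebra and thus contains the vertex cover algebra. Each monomial of a
  \<open>k\<close>-cover then lies in a span of monomials, so it is itself a product, and its degree
  fixes the number of factors.\<close>

lemma products_generators:
  assumes "bipartite_graph n E" "\<And>C. minimal_vertex_cover n E C \<Longrightarrow> card C = n"
  shows "products (degree_one_generators n E :: 'k::field polyS poly set) d =
    case_prod mon ` cover_exponents n E d"
proof
  let ?B = "degree_one_generators n E :: 'k polyS poly set"
  have sub: "products ?B d \<subseteq> case_prod mon ` cover_exponents n E d" for d
  proof (induction d)
    case 0
    have "(0, 0) \<in> cover_exponents n E 0" by (simp add: cover_exponents_def vertex_cover_vector_def)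
    moreover have "1 = (mon 0 0 :: 'k polyS poly)" by (simp add: mon_def)
    ultimately show ?case by (force simp: products_0)
  next
    case (Suc d)
    show ?case
    proof
      fix f assume "f \<in> products ?B (Suc d)"
      then obtain g h where f: "f = g * h" "g \<in> products ?B d" "h \<in> ?B"
        by (auto simp: products_Suc)
      obtain c k where g: "g = mon c k" "(c, k) \<in> cover_exponents n E d" using f(2) Suc.IH by auto
      obtain c' k' where h: "h = mon c' k'" "(c', k') \<in> cover_exponents n E 1"
        using degree_one_exponents[OF assms(2) f(3)] by blast
      have "f = mon (c + c') (k + k')" by (simp add: f g h mon_mult)
      with cover_exponents_add[OF g(2) h(2)] show "f \<in> case_prod mon ` cover_exponents n E (Suc d)"
        by force
    qed
  qed
  then show "products ?B d \<subseteq> case_prod mon ` cover_exponents n E d" .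
  show "case_prod mon ` cover_exponents n E d \<subseteq> products ?B d"
  proof clarify
    fix c k assume ck: "(c, k) \<in> cover_exponents n E d"
    define Q where "Q = (\<Union>d. products ?B d)"
    \<comment> \<open>\<open>M\<close> exhibits \<open>Q\<close> as a set of monomials, so that
      \<open>mon_in_span_iff\<close> applies.\<close>
    define M where "M = {(c, k). (mon c k :: 'k polyS poly) \<in> Q}"
    have Q: "Q = case_prod mon ` M" using sub by (force simp: M_def Q_def)
    have "is_subalgebra (St.span Q)"
      unfolding is_subalgebra_def
    proof (intro conjI ballI)
      have "1 \<in> products ?B 0" by (simp add: products_0)
      then show "1 \<in> St.span Q" unfolding Q_def by (intro St.span_base) blast
      show "f * g \<in> St.span Q" if "f \<in> St.span Q" "g \<in> St.span Q" for f g
        by (rule span_mult_closed[OF _ that]) (auto simp: Q_def intro: products_mult)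
    qed (rule St.subspace_span)
    moreover have "?B \<subseteq> products ?B (Suc 0)" by (auto simp: products_Suc products_0)
    then have "?B \<subseteq> St.span Q" unfolding Q_def by (blast intro: St.span_base)
    ultimately have "vertex_cover_algebra n E \<subseteq> St.span Q"
      unfolding vertex_cover_algebra_generators[OF assms(1)] by (intro hull_minimal)
    moreover have "vertex_cover_vector n E k c" using ck by (simp add: cover_exponents_def)
    then have "(mon c k :: 'k polyS poly) \<in> vertex_cover_algebra n E"
      unfolding vertex_cover_algebra_def by (intro hull_inc) blast
    ultimately have "(mon c k :: 'k polyS poly) \<in> Q"
      using mon_in_span_iff[of c k M, where 'k = 'k] unfolding Q by (auto intro!: image_eqI[of _ _ "(c, k)"])
    then obtain e where e: "(mon c k :: 'k polyS poly) \<in> products ?B e" by (auto simp: Q_def)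
    then have "(c, k) \<in> cover_exponents n E e" using sub[of e] by (auto simp: mon_eq_iff)
    \<comment> \<open>The equation in \<open>cover_exponents\<close> determines the degree from
      \<open>c\<close> and \<open>k\<close>.\<close>
    then have "e = d" using ck by (simp add: cover_exponents_def)
    then show "(mon c k :: 'k polyS poly) \<in> products ?B d" using e by simp
  qed
qed

text \<open>All monomials in question lie in the algebra, so the homogeneous part is their full
  span, with these monomials as a basis.\<close>

lemma hilbert_function_vertex_cover_algebra:
  assumes "bipartite_graph n E" "\<And>C. minimal_vertex_cover n E C \<Longrightarrow> card C = n"
  shows "hilbert_function (vertex_cover_algebra n E :: 'k::field polyS poly set)
    (degree_one_generators n E) d = card (cover_exponents n E d)"
proof -
  let ?A = "vertex_cover_algebra n E :: 'k polyS poly set"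
  have "is_subalgebra ?A" unfolding vertex_cover_algebra_def by (rule is_subalgebra_hull)
  then have "St.subspace ?A" by (simp add: is_subalgebra_def)
  moreover have "case_prod mon ` cover_exponents n E d \<subseteq> ?A"
    unfolding vertex_cover_algebra_def
    by (intro order.trans[OF _ hull_subset]) (auto simp: cover_exponents_def)
  ultimately have "St.span (case_prod mon ` cover_exponents n E d) \<subseteq> ?A"
    by (intro St.span_minimal)
  then have "homogeneous_part ?A (degree_one_generators n E) d =
      St.span (case_prod mon ` cover_exponents n E d)"
    using products_generators[OF assms, where 'k = 'k and d = d]
    by (simp add: homogeneous_part_def Int_absorb1 flip: products_def)
  then show ?thesis by (simp only: hilbert_function_def dim_span_mon)
qed


section \<open>Covers of a poset graph\<close>

lemma sum_V: "(\<Sum>u\<in>V n. c u) = (\<Sum>i\<in>{1..n}. c (X i) + c (Y i))"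
proof -
  have "X ` {1..n} \<inter> Y ` {1..n} = {}" by auto
  then have "(\<Sum>u\<in>V n. c u) = (\<Sum>u\<in>X ` {1..n}. c u) + (\<Sum>u\<in>Y ` {1..n}. c u)"
    unfolding V_def by (intro sum.union_disjoint) auto
  also have "\<dots> = (\<Sum>i\<in>{1..n}. c (X i)) + (\<Sum>i\<in>{1..n}. c (Y i))"
    by (subst (1 2) sum.reindex) (auto simp: inj_on_def)
  finally show ?thesis by (simp add: sum.distrib)
qed

lemma card_V: "card (V n) = 2 * n"
  using sum_V[of "\<lambda>_. 1 :: nat" n] by simp

lemma X_in_V [simp]: "X i \<in> V n \<longleftrightarrow> i \<in> {1..n}"
  and Y_in_V [simp]: "Y i \<in> V n \<longleftrightarrow> i \<in> {1..n}"
  by (auto simp: V_def)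

text \<open>The order of the poset, carried over to the labels \<open>1..n\<close>.
  \<open>R_le\<close> says that the labelling is a linear extension, and antisymmetry follows from
  it.\<close>

locale natural_labelling =
  fixes n :: nat and R :: "nat \<Rightarrow> nat \<Rightarrow> bool"
  assumes R_carrier: "R i j \<Longrightarrow> i \<in> {1..n} \<and> j \<in> {1..n}"
    and R_refl: "i \<in> {1..n} \<Longrightarrow> R i i"
    and R_trans: "R i j \<Longrightarrow> R j k \<Longrightarrow> R i k"
    and R_le: "R i j \<Longrightarrow> i \<le> j"
begin

section \<open>Order reversing maps and their jumps\<close>

lemma R_antisym: "R i j \<Longrightarrow> R j i \<Longrightarrow> i = j"
  using R_le[of i j] R_le[of j i] by simp

text \<open>The least order reversing map above \<open>h\<close> on the labels.\<close>

definition upper_max :: "(nat \<Rightarrow> nat) \<Rightarrow> nat \<Rightarrow> nat" where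
  "upper_max h i = Max (h ` {j. R i j})"

lemma finite_R: "finite {j. R i j}"
  by (rule finite_subset[of _ "{1..n}"]) (use R_carrier in auto)

lemma upper_max_ge: "R i j \<Longrightarrow> h j \<le> upper_max h i"
  unfolding upper_max_def using finite_R by (intro Max_ge) auto

lemma upper_max_attained:
  assumes "i \<in> {1..n}"
  obtains j where "R i j" "upper_max h i = h j"
proof -
  have "upper_max h i \<in> h ` {j. R i j}"
    unfolding upper_max_def using finite_R R_refl[OF assms] by (intro Max_in) auto
  then show thesis using that by blast
qed

lemma upper_max_antimono: "R i j \<Longrightarrow> upper_max h j \<le> upper_max h i"
  by (metis R_carrier R_trans upper_max_attained upper_max_ge)

definition jumps :: "(nat \<Rightarrow> nat) \<Rightarrow> nat set" where
  "jumps w = {i \<in> {1..n}. 0 < w i \<and> (\<forall>j. R i j \<and> j \<noteq> i \<longrightarrow> w j < w i)}"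

text \<open>The value 0 outside \<open>S\<close> gives each map on \<open>S\<close> a unique
  representative, and such labels never raise \<open>upper_max\<close>.\<close>

definition strict_maps :: "nat set \<Rightarrow> nat \<Rightarrow> (nat \<Rightarrow> nat) set" where
  "strict_maps S k = {v. (\<forall>i. i \<notin> S \<longrightarrow> v i = 0) \<and> (\<forall>i\<in>S. 1 \<le> v i \<and> v i \<le> k) \<and>
     (\<forall>i\<in>S. \<forall>j\<in>S. R i j \<and> i \<noteq> j \<longrightarrow> v j < v i)}"

text \<open>An order reversing map is recovered from its jumps: going up from \<open>i\<close> while
  the value stays the same ends at a jump with that value.\<close>

lemma upper_max_jumps:
  assumes antimono: "\<And>i j. R i j \<Longrightarrow> w j \<le> w i" and "i \<in> {1..n}"
  shows "upper_max (\<lambda>j. if j \<in> jumps w then w j else 0) i = w i" (is "upper_max ?v i = _")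
proof (rule antisym)
  show "upper_max ?v i \<le> w i"
    by (rule upper_max_attained[OF assms(2), of ?v]) (use antimono in auto)
  show "w i \<le> upper_max ?v i"
  proof (cases "w i = 0")
    case False
    \<comment> \<open>By \<open>R_le\<close>, the largest label is maximal in the order among the
      elements above \<open>i\<close> with the value \<open>w i\<close>.\<close>
    define j where "j = Max {j. R i j \<and> w j = w i}"
    have fin: "finite {j. R i j \<and> w j = w i}" by (rule finite_subset[OF _ finite_R[of i]]) auto
    have "j \<in> {j. R i j \<and> w j = w i}"
      unfolding j_def using fin R_refl[OF assms(2)] by (intro Max_in) auto
    then have j: "R i j" "w j = w i" by auto
    have "w l < w j" if "R j l" "l \<noteq> j" for l
    proof (rule ccontr)
      assume "\<not> w l < w j"
      with antimono[OF that(1)] j have "l \<in> {j. R i j \<and> w j = w i}"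
        using R_trans[OF j(1) that(1)] by auto
      then have "l \<le> j" unfolding j_def using fin by (intro Max_ge)
      with R_le[OF that(1)] that(2) show False by simp
    qed
    then have "j \<in> jumps w" using j False R_carrier[OF j(1)] by (auto simp: jumps_def)
    then show ?thesis using upper_max_ge[OF j(1), of ?v] j by simp
  qed simp
qed

lemma strict_maps_le: "v \<in> strict_maps S k \<Longrightarrow> v i \<le> k"
  unfolding strict_maps_def by (cases "i \<in> S") auto

lemma upper_max_le: "v \<in> strict_maps S k \<Longrightarrow> i \<in> {1..n} \<Longrightarrow> upper_max v i \<le> k"
  by (metis strict_maps_le upper_max_attained)

context
  fixes S v k
  assumes S: "S \<subseteq> {1..n}" and v: "v \<in> strict_maps S k"
begin

text \<open>Above \<open>i\<close>, the other elements of \<open>S\<close> have smaller values and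
  the elements outside \<open>S\<close> have value 0.\<close>

lemma upper_max_strict_map:
  assumes "i \<in> S"
  shows "upper_max v i = v i"
proof (rule antisym)
  have i: "i \<in> {1..n}" using assms S by blast
  obtain j where j: "R i j" "upper_max v i = v j" by (rule upper_max_attained[OF i])
  show "upper_max v i \<le> v i"
    using j v assms unfolding strict_maps_def by (cases "j = i"; cases "j \<in> S") force+
  show "v i \<le> upper_max v i" by (rule upper_max_ge[OF R_refl[OF i]])
qed

text \<open>The converse of \<open>upper_max_jumps\<close>. If \<open>i\<close> is outside
  \<open>S\<close>, a positive maximum is attained at some \<open>l\<close> strictly above
  \<open>i\<close>, and there \<open>upper_max v\<close> is just as large, so \<open>i\<close> is no
  jump.\<close>

lemma jumps_upper_max: "jumps (upper_max v) = S"
proof (intro equalityI subsetI)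
  fix i assume i: "i \<in> S"
  have "upper_max v j < v i" if "R i j" "j \<noteq> i" for j
  proof -
    have "j \<in> {1..n}" using R_carrier[OF that(1)] by simp
    then obtain l where l: "R j l" "upper_max v j = v l" by (rule upper_max_attained)
    have "R i l" "l \<noteq> i" using R_trans[OF that(1) l(1)] R_antisym[OF that(1)] l(1) that(2) by auto
    then show ?thesis using v i l(2) unfolding strict_maps_def by (cases "l \<in> S") force+
  qed
  moreover have "0 < v i" using v i by (force simp: strict_maps_def)
  ultimately show "i \<in> jumps (upper_max v)"
    using i S upper_max_strict_map[OF i] by (auto simp: jumps_def)
next
  fix i assume i: "i \<in> jumps (upper_max v)"
  then have "i \<in> {1..n}" by (simp add: jumps_def)
  then obtain l where l: "R i l" "upper_max v i = v l" by (rule upper_max_attained)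
  show "i \<in> S"
  proof (rule ccontr)
    assume "i \<notin> S"
    then have "v i = 0" using v by (simp add: strict_maps_def)
    with l i have "l \<noteq> i" by (auto simp: jumps_def)
    then have "upper_max v l < upper_max v i" using i l(1) by (simp add: jumps_def)
    moreover have "v l \<le> upper_max v l"
      by (rule upper_max_ge[OF R_refl]) (use R_carrier[OF l(1)] in simp)
    ultimately show False using l(2) by simp
  qed
qed

end

section \<open>Decomposition of covers into cells\<close>

definition covers :: "nat \<Rightarrow> ((vertex \<Rightarrow> nat) \<times> nat) set" where
  "covers d = {(c, k). (\<forall>u. u \<notin> V n \<longrightarrow> c u = 0) \<and> (\<forall>i j. R i j \<longrightarrow> k \<le> c (X i) + c (Y j)) \<and>
     (\<Sum>u\<in>V n. c u) + k = d + n * k}"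

text \<open>The smallest values that a \<open>k\<close>-cover with the values of \<open>c\<close> on the \<open>Y j\<close> can take
  on the \<open>X i\<close>.\<close>

definition height :: "(vertex \<Rightarrow> nat) \<Rightarrow> nat \<Rightarrow> nat \<Rightarrow> nat" where
  "height c k = upper_max (\<lambda>j. k - c (Y j))"

text \<open>\<open>S\<close> is the jump set, \<open>v\<close> gives the values there and
  \<open>g\<close> is the excess. A cover has no excess at \<open>Y i\<close> for \<open>i\<close>
  in \<open>S\<close>, which leaves \<open>2 * n - card S\<close> free coordinates.\<close>

definition cells :: "nat set \<Rightarrow> nat \<Rightarrow> ((nat \<Rightarrow> nat) \<times> (vertex \<Rightarrow> nat) \<times> nat) set" where
  "cells S d = {(v, g, k). v \<in> strict_maps S k \<and> (\<forall>u. u \<notin> V n - Y ` S \<longrightarrow> g u = 0) \<and>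
     sum g (V n - Y ` S) + k = d}"

text \<open>The function part takes the excess over the \<open>k\<close>-cover with values
  \<open>w i\<close> on \<open>X i\<close> and \<open>k - w i\<close> on \<open>Y i\<close>.\<close>

definition to_cell :: "(vertex \<Rightarrow> nat) \<times> nat \<Rightarrow> (nat \<Rightarrow> nat) \<times> (vertex \<Rightarrow> nat) \<times> nat" where
  "to_cell = (\<lambda>(c, k). let w = height c k in
     (\<lambda>i. if i \<in> jumps w then w i else 0,
      \<lambda>u. if u \<in> V n then case u of X i \<Rightarrow> c u - w i | Y i \<Rightarrow> w i + c u - k else 0,
      k))"

definition of_cell :: "(nat \<Rightarrow> nat) \<times> (vertex \<Rightarrow> nat) \<times> nat \<Rightarrow> (vertex \<Rightarrow> nat) \<times> nat" where
  "of_cell = (\<lambda>(v, g, k).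
     (\<lambda>u. if u \<in> V n then case u of X i \<Rightarrow> upper_max v i + g u | Y i \<Rightarrow> k + g u - upper_max v i else 0,
      k))"

text \<open>The first two bounds make the truncated subtractions in \<open>to_cell\<close> exact.
  The third bounds the values of the strict map.\<close>

lemma height_bounds:
  assumes "(c, k) \<in> covers d" "i \<in> {1..n}"
  shows "height c k i \<le> c (X i)" "k \<le> height c k i + c (Y i)" "height c k i \<le> k"
proof -
  obtain j where j: "R i j" "height c k i = k - c (Y j)"
    using upper_max_attained[OF assms(2)] unfolding height_def by metis
  then show "height c k i \<le> c (X i)" "height c k i \<le> k"
    using assms(1) by (auto simp: covers_def le_diff_conv)
  show "k \<le> height c k i + c (Y i)"
    using upper_max_ge[OF R_refl[OF assms(2)], of "\<lambda>j. k - c (Y j)"] by (simp add: height_def)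
qed

text \<open>At a jump the maximum cannot be attained at another \<open>j\<close> above
  \<open>i\<close>, since the height at \<open>j\<close> is smaller. So it is attained at
  \<open>i\<close> itself, and being positive it makes \<open>k - c (Y i)\<close> an exact
  difference.\<close>

lemma height_jump:
  assumes "(c, k) \<in> covers d" "i \<in> jumps (height c k)"
  shows "height c k i + c (Y i) = k"
proof -
  have i: "i \<in> {1..n}" using assms(2) by (simp add: jumps_def)
  obtain j where j: "R i j" "height c k i = k - c (Y j)"
    using upper_max_attained[OF i] unfolding height_def by metis
  have "k - c (Y j) \<le> height c k j"
    unfolding height_def by (rule upper_max_ge[OF R_refl]) (use R_carrier[OF j(1)] in simp)
  then have "j = i" using assms(2) j by (force simp: jumps_def)
  then show ?thesis using j assms(2) by (auto simp: jumps_def)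
qed

lemma to_cell_in_cells:
  assumes "(c, k) \<in> covers d"
  shows "to_cell (c, k) \<in> cells (jumps (height c k)) d"
proof -
  define w where "w = height c k"
  define v where "v = (\<lambda>i. if i \<in> jumps w then w i else 0)"
  define g where "g = (\<lambda>u. if u \<in> V n then case u of X i \<Rightarrow> c u - w i | Y i \<Rightarrow> w i + c u - k else 0)"
  have eq: "to_cell (c, k) = (v, g, k)" unfolding to_cell_def v_def g_def w_def Let_def by simp
  note b = height_bounds[OF assms, folded w_def]
  have "v \<in> strict_maps (jumps w) k"
    using b(3) by (auto simp: strict_maps_def v_def jumps_def)
  moreover have g0: "g u = 0" if "u \<notin> V n - Y ` jumps w" for u
    using that height_jump[OF assms, folded w_def] by (auto simp: g_def)
  moreover have "sum g (V n - Y ` jumps w) = sum g (V n)"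
    using g0 finite_V by (intro sum.mono_neutral_left) auto
  moreover have "sum g (V n) + n * k = sum c (V n)"
  proof -
    \<comment> \<open>Each pair \<open>X i\<close>, \<open>Y i\<close> loses \<open>w i\<close> and
      \<open>k - w i\<close>, together \<open>k\<close>.\<close>
    have "sum g (V n) + n * k = (\<Sum>i\<in>{1..n}. g (X i) + g (Y i) + k)"
      by (simp add: sum_V sum.distrib)
    also have "\<dots> = (\<Sum>i\<in>{1..n}. c (X i) + c (Y i))"
    proof (rule sum.cong)
      fix i assume i: "i \<in> {1..n}"
      then have "g (X i) = c (X i) - w i" "g (Y i) = w i + c (Y i) - k" by (simp_all add: g_def)
      with b[OF i] show "g (X i) + g (Y i) + k = c (X i) + c (Y i)" by simp
    qed simp
    finally show ?thesis by (simp add: sum_V)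
  qed
  ultimately show ?thesis using assms by (auto simp: eq cells_def covers_def w_def)
qed

lemma of_cell_to_cell:
  assumes "(c, k) \<in> covers d"
  shows "of_cell (to_cell (c, k)) = (c, k)"
proof -
  define w where "w = height c k"
  note b = height_bounds[OF assms, folded w_def]
  have antimono: "w j \<le> w i" if "R i j" for i j
    unfolding w_def height_def by (rule upper_max_antimono[OF that])
  note um = upper_max_jumps[of w, OF antimono]
  have "to_cell (c, k) = (\<lambda>i. if i \<in> jumps w then w i else 0,
      \<lambda>u. if u \<in> V n then case u of X i \<Rightarrow> c u - w i | Y i \<Rightarrow> w i + c u - k else 0, k)"
    unfolding to_cell_def w_def Let_def by simp
  then have "of_cell (to_cell (c, k)) = (\<lambda>u. if u \<in> V n then case u of
      X i \<Rightarrow> w i + (c u - w i) | Y i \<Rightarrow> k + (w i + c u - k) - w i else 0, k)"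
    using um by (auto simp: of_cell_def fun_eq_iff split: vertex.split)
  also have "\<dots> = (c, k)"
    using b assms by (auto simp: fun_eq_iff covers_def split: vertex.split)
  finally show ?thesis .
qed

text \<open>On \<open>Y j\<close> the cover is at least \<open>k - upper_max v j\<close>, with
  equality for \<open>j\<close> in \<open>S\<close>, where there is no excess. Hence
  \<open>height\<close> and \<open>upper_max v\<close> bound each other.\<close>

lemma of_cell_in_covers:
  assumes S: "S \<subseteq> {1..n}" and cell: "(v, g, k) \<in> cells S d"
  defines "c \<equiv> fst (of_cell (v, g, k))"
  shows "(c, k) \<in> covers d" "\<And>i. i \<in> {1..n} \<Longrightarrow> height c k i = upper_max v i"
proof -
  let ?w = "upper_max v"
  have v: "v \<in> strict_maps S k" and g: "\<And>u. u \<notin> V n - Y ` S \<Longrightarrow> g u = 0"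
    and sum: "sum g (V n - Y ` S) + k = d"
    using cell by (auto simp: cells_def)
  have cX: "c (X i) = ?w i + g (X i)" and cY: "c (Y i) = k + g (Y i) - ?w i" if "i \<in> {1..n}" for i
    using that by (simp_all add: c_def of_cell_def)
  have le: "?w i \<le> k" if "i \<in> {1..n}" for i using upper_max_le[OF v that] .
  have "k \<le> c (X i) + c (Y j)" if "R i j" for i j
    using upper_max_antimono[OF that, of v] R_carrier[OF that] by (auto simp: cX cY)
  moreover have "c u = 0" if "u \<notin> V n" for u using that by (simp add: c_def of_cell_def)
  moreover have "sum c (V n) = sum g (V n) + n * k"
  proof -
    have "sum c (V n) = (\<Sum>i\<in>{1..n}. c (X i) + c (Y i))" by (rule sum_V)
    also have "\<dots> = (\<Sum>i\<in>{1..n}. g (X i) + g (Y i) + k)"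
    proof (rule sum.cong)
      fix i assume "i \<in> {1..n}"
      then show "c (X i) + c (Y i) = g (X i) + g (Y i) + k" using le[of i] by (simp add: cX cY)
    qed simp
    also have "\<dots> = sum g (V n) + n * k" by (simp add: sum_V sum.distrib)
    finally show ?thesis .
  qed
  moreover have "sum g (V n - Y ` S) = sum g (V n)"
    using g finite_V by (intro sum.mono_neutral_left) auto
  ultimately show "(c, k) \<in> covers d" using sum by (simp add: covers_def)
  fix i assume i: "i \<in> {1..n}"
  show "height c k i = ?w i"
  proof (rule antisym)
    obtain j where j: "R i j" "height c k i = k - c (Y j)"
      using upper_max_attained[OF i] unfolding height_def by metis
    then show "height c k i \<le> ?w i"
      using upper_max_antimono[OF j(1), of v] R_carrier[OF j(1)] by (auto simp: cY)
    obtain l where l: "R i l" "?w i = v l" by (rule upper_max_attained[OF i])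
    show "?w i \<le> height c k i"
    proof (cases "l \<in> S")
      case True
      then have "g (Y l) = 0" "?w l = v l" using g upper_max_strict_map[OF S v] by auto
      then have "k - c (Y l) = v l" using R_carrier[OF l(1)] le[of l] by (simp add: cY)
      then show ?thesis
        using upper_max_ge[OF l(1), of "\<lambda>j. k - c (Y j)"] l(2) by (simp add: height_def)
    next
      case False
      then show ?thesis using v l(2) by (simp add: strict_maps_def)
    qed
  qed
qed

lemma jumps_cong: "(\<And>i. i \<in> {1..n} \<Longrightarrow> w i = w' i) \<Longrightarrow> jumps w = jumps w'"
  unfolding jumps_def using R_carrier by (intro Collect_cong) metis

lemma to_cell_of_cell:
  assumes S: "S \<subseteq> {1..n}" and cell: "(v, g, k) \<in> cells S d"
  shows "to_cell (of_cell (v, g, k)) = (v, g, k)"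
    "jumps (height (fst (of_cell (v, g, k))) k) = S"
proof -
  define c where "c = fst (of_cell (v, g, k))"
  have ck: "of_cell (v, g, k) = (c, k)" by (simp add: c_def of_cell_def)
  have v: "v \<in> strict_maps S k" and g: "\<And>u. u \<notin> V n - Y ` S \<Longrightarrow> g u = 0"
    using cell by (auto simp: cells_def)
  note h = of_cell_in_covers(2)[OF assms, folded c_def]
  have jumps: "jumps (height c k) = S"
    using jumps_upper_max[OF S v] jumps_cong[OF h] by simp
  then show "jumps (height (fst (of_cell (v, g, k))) k) = S" by (simp add: c_def)
  have "fst (to_cell (c, k)) i = v i" for i
    using v S upper_max_strict_map[OF S v, of i] h[of i]
    by (auto simp: to_cell_def Let_def jumps strict_maps_def)
  moreover have "fst (snd (to_cell (c, k))) u = g u" for u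
  proof (cases "u \<in> V n")
    case True
    then show ?thesis
      using upper_max_le[OF v] h
      by (cases u) (simp_all add: to_cell_def Let_def c_def of_cell_def trans_le_add1)
  next
    case False
    then show ?thesis using g[of u] by (simp add: to_cell_def Let_def)
  qed
  moreover have "snd (snd (to_cell (c, k))) = k" by (simp add: to_cell_def Let_def)
  ultimately show "to_cell (of_cell (v, g, k)) = (v, g, k)"
    unfolding ck by (metis ext prod.collapse)
qed

text \<open>The cells of different \<open>S\<close> have disjoint images because the jump set can be
  read off from the cover.\<close>

lemma card_covers:
  assumes "\<And>S. S \<subseteq> {1..n} \<Longrightarrow> finite (cells S d)"
  shows "card (covers d) = (\<Sum>S\<in>Pow {1..n}. card (cells S d))"
proof -
  have covers: "covers d = (\<Union>S\<in>Pow {1..n}. of_cell ` cells S d)"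
  proof (intro equalityI subsetI)
    fix x assume "x \<in> covers d"
    moreover obtain c k where "x = (c, k)" by (cases x)
    ultimately have "x \<in> of_cell ` cells (jumps (height c k)) d"
      using to_cell_in_cells of_cell_to_cell by (metis image_eqI)
    moreover have "jumps (height c k) \<in> Pow {1..n}" by (auto simp: jumps_def)
    ultimately show "x \<in> (\<Union>S\<in>Pow {1..n}. of_cell ` cells S d)" by blast
  next
    fix x assume "x \<in> (\<Union>S\<in>Pow {1..n}. of_cell ` cells S d)"
    then obtain S v g k where *: "S \<subseteq> {1..n}" "(v, g, k) \<in> cells S d" "x = of_cell (v, g, k)"
      by auto
    then show "x \<in> covers d" using of_cell_in_covers(1)[OF *(1,2)] by (simp add: of_cell_def)
  qed
  have "card (covers d) = (\<Sum>S\<in>Pow {1..n}. card (of_cell ` cells S d))"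
    unfolding covers
  proof (rule card_UN_disjoint)
    show "\<forall>S\<in>Pow {1..n}. \<forall>T\<in>Pow {1..n}. S \<noteq> T \<longrightarrow> of_cell ` cells S d \<inter> of_cell ` cells T d = {}"
    proof (intro ballI impI equals0I)
      fix S T x assume ST: "S \<in> Pow {1..n}" "T \<in> Pow {1..n}" "S \<noteq> T"
        and x: "x \<in> of_cell ` cells S d \<inter> of_cell ` cells T d"
      have *: "jumps (height (fst x) (snd x)) = U" if "x \<in> of_cell ` cells U d" "U \<in> Pow {1..n}" for U
      proof -
        from that obtain v g k where vgk: "(v, g, k) \<in> cells U d" "x = of_cell (v, g, k)" by auto
        moreover have "snd x = k" by (simp add: vgk of_cell_def)
        ultimately show ?thesis using to_cell_of_cell(2)[of U v g k d] that(2) by simp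
      qed
      show False using *[of S] *[of T] x ST by blast
    qed
  qed (use assms in auto)
  also have "\<dots> = (\<Sum>S\<in>Pow {1..n}. card (cells S d))"
  proof (intro sum.cong refl card_image inj_onI)
    fix S x y assume *: "S \<in> Pow {1..n}" "x \<in> cells S d" "y \<in> cells S d" "of_cell x = of_cell y"
    moreover obtain v g k v' g' k' where "x = (v, g, k)" "y = (v', g', k')" by (metis prod_cases3)
    ultimately show "x = y" using to_cell_of_cell(1)[of S] by (metis PowD)
  qed
  finally show ?thesis .
qed

section \<open>Strict maps counted by linear extensions\<close>

text \<open>The linear extensions of all subsets of the poset. Distinctness follows from reflexivity.\<close>

definition extensions :: "nat list set" where
  "extensions = {xs. set xs \<subseteq> {1..n} \<and> sorted_wrt (\<lambda>a b. \<not> R b a) xs}"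

text \<open>The possible fibres of the top value in a strict map on \<open>S\<close>.\<close>

definition bottoms :: "nat set \<Rightarrow> nat set set" where
  "bottoms S = {T. T \<subseteq> S \<and> (\<forall>i\<in>T. \<forall>j\<in>S. R j i \<longrightarrow> j = i)}"

text \<open>The labels with value \<open>Suc k\<close> are minimal elements of \<open>S\<close>.
  Removing them leaves a strict map to \<open>1..k\<close>.\<close>

lemma strict_maps_Suc:
  "strict_maps S (Suc k) =
    (\<Union>T\<in>bottoms S. (\<lambda>v i. if i \<in> T then Suc k else v i) ` strict_maps (S - T) k)"
proof (intro equalityI subsetI)
  fix v assume v: "v \<in> strict_maps S (Suc k)"
  define T where "T = {i \<in> S. v i = Suc k}"
  define v' where "v' i = (if i \<in> T then 0 else v i)" for i
  have "T \<in> bottoms S"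
    unfolding bottoms_def
  proof (intro CollectI conjI ballI impI)
    fix i j assume ij: "i \<in> T" "j \<in> S" "R j i"
    show "j = i"
    proof (rule ccontr)
      assume "j \<noteq> i"
      with ij v have "v i < v j" unfolding strict_maps_def T_def by blast
      moreover have "v j \<le> Suc k" by (rule strict_maps_le[OF v])
      ultimately show False using ij(1) by (simp add: T_def)
    qed
  qed (auto simp: T_def)
  moreover have "v' \<in> strict_maps (S - T) k"
    using v by (auto simp: strict_maps_def v'_def T_def le_Suc_eq)
  moreover have "v = (\<lambda>i. if i \<in> T then Suc k else v' i)"
    by (auto simp: v'_def T_def fun_eq_iff)
  ultimately show "v \<in> (\<Union>T\<in>bottoms S. (\<lambda>v i. if i \<in> T then Suc k else v i) ` strict_maps (S - T) k)"
    by blast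
next
  fix v assume "v \<in> (\<Union>T\<in>bottoms S. (\<lambda>v i. if i \<in> T then Suc k else v i) ` strict_maps (S - T) k)"
  then obtain T v' where T: "T \<in> bottoms S" and v': "v' \<in> strict_maps (S - T) k"
    and v: "v = (\<lambda>i. if i \<in> T then Suc k else v' i)" by blast
  show "v \<in> strict_maps S (Suc k)"
    unfolding strict_maps_def
  proof (intro CollectI conjI ballI impI allI)
    fix i j assume ij: "i \<in> S" "j \<in> S" "R i j \<and> i \<noteq> j"
    then have "j \<notin> T" using T by (auto simp: bottoms_def)
    with ij v' have "v' j \<le> k" and "i \<notin> T \<Longrightarrow> v' j < v' i" by (auto simp: strict_maps_def)
    with \<open>j \<notin> T\<close> show "v j < v i" by (auto simp: v)
  qed (use T v' strict_maps_le[OF v'] in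
      \<open>auto simp: strict_maps_def bottoms_def v intro: le_SucI\<close>)
qed

lemma finite_strict_maps:
  assumes "finite S"
  shows "finite (strict_maps S k)"
proof (rule finite_subset)
  show "strict_maps S k \<subseteq> {v. \<forall>i. (i \<in> S \<longrightarrow> v i \<in> {..k}) \<and> (i \<notin> S \<longrightarrow> v i = 0)}"
    by (auto simp: strict_maps_def)
  show "finite {v. \<forall>i. (i \<in> S \<longrightarrow> v i \<in> {..k}) \<and> (i \<notin> S \<longrightarrow> v i = 0)}"
    by (rule finite_set_of_finite_funs) (use assms in auto)
qed

lemma finite_bottoms: "finite S \<Longrightarrow> finite (bottoms S)"
  by (rule finite_subset[of _ "Pow S"]) (auto simp: bottoms_def)

lemma card_strict_maps_Suc:
  assumes "finite S"
  shows "card (strict_maps S (Suc k)) = (\<Sum>T\<in>bottoms S. card (strict_maps (S - T) k))"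
proof -
  let ?f = "\<lambda>T v i. if i \<in> T then Suc k else v i :: nat"
  \<comment> \<open>A map with values up to \<open>k\<close> never takes the value
    \<open>Suc k\<close>, so \<open>T\<close> can be recovered. This makes the union
    disjoint.\<close>
  have T: "{i. ?f T v i = Suc k} = T" if "v \<in> strict_maps (S - T) k" for v T
    using strict_maps_le[OF that] by (auto simp: not_less_eq_eq[symmetric] split: if_splits)
      (metis not_less_eq_eq order_refl)
  have "card (strict_maps S (Suc k)) = (\<Sum>T\<in>bottoms S. card (?f T ` strict_maps (S - T) k))"
    unfolding strict_maps_Suc
  proof (rule card_UN_disjoint)
    show "\<forall>T\<in>bottoms S. \<forall>U\<in>bottoms S. T \<noteq> U \<longrightarrow>
        ?f T ` strict_maps (S - T) k \<inter> ?f U ` strict_maps (S - U) k = {}"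
    proof (intro ballI impI equals0I)
      fix T U w assume "T \<noteq> U" "w \<in> ?f T ` strict_maps (S - T) k \<inter> ?f U ` strict_maps (S - U) k"
      then obtain v v' where w: "w = ?f T v" "v \<in> strict_maps (S - T) k"
        "w = ?f U v'" "v' \<in> strict_maps (S - U) k" by blast
      have "{i. w i = Suc k} = T" using T[OF w(2)] by (simp only: w(1))
      moreover have "{i. w i = Suc k} = U" using T[OF w(4)] by (simp only: w(3))
      ultimately show False using \<open>T \<noteq> U\<close> by simp
    qed
  qed (use assms in \<open>auto intro: finite_bottoms finite_strict_maps\<close>)
  also have "\<dots> = (\<Sum>T\<in>bottoms S. card (strict_maps (S - T) k))"
  proof (intro sum.cong refl card_image inj_onI)
    fix T v v' assume *: "v \<in> strict_maps (S - T) k" "v' \<in> strict_maps (S - T) k" "?f T v = ?f T v'"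
    show "v = v'"
    proof
      fix i show "v i = v' i"
        using * fun_cong[OF *(3), of i] by (cases "i \<in> T") (auto simp: strict_maps_def)
    qed
  qed
  finally show ?thesis .
qed

lemma distinct_extension: "xs \<in> extensions \<Longrightarrow> distinct xs"
proof (induction xs)
  case (Cons x xs)
  then show ?case using R_refl by (auto simp: extensions_def)
qed simp

lemma finite_extensions: "finite extensions"
proof (rule finite_subset)
  show "extensions \<subseteq> {xs. set xs \<subseteq> {1..n} \<and> distinct xs}"
    using distinct_extension by (auto simp: extensions_def)
qed (rule finite_subset_distinct, simp)

text \<open>The first entry of a linear extension of \<open>S\<close> is a minimal element of
  \<open>S\<close>, and every minimal element can come first.\<close>

lemma card_extensions_rec:
  assumes "S \<subseteq> {1..n}" "S \<noteq> {}"
  shows "card {xs \<in> extensions. set xs = S} =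
    (\<Sum>i | {i} \<in> bottoms S. card {xs \<in> extensions. set xs = S - {i}})"
proof -
  let ?L = "\<lambda>S. {xs \<in> extensions. set xs = S}"
  have fin: "finite (?L S)" for S using finite_extensions by simp
  have "?L S = (\<Union>i\<in>{i. {i} \<in> bottoms S}. (#) i ` ?L (S - {i}))"
  proof (intro equalityI subsetI)
    fix xs assume xs: "xs \<in> ?L S"
    then obtain i ys where i: "xs = i # ys" using assms(2) by (cases xs) auto
    have "distinct xs" using xs distinct_extension by simp
    then have "ys \<in> ?L (S - {i})" using xs i by (auto simp: extensions_def)
    moreover have "{i} \<in> bottoms S" using xs i by (auto simp: bottoms_def extensions_def)
    ultimately show "xs \<in> (\<Union>i\<in>{i. {i} \<in> bottoms S}. (#) i ` ?L (S - {i}))" using i by blast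
  next
    fix xs assume "xs \<in> (\<Union>i\<in>{i. {i} \<in> bottoms S}. (#) i ` ?L (S - {i}))"
    then show "xs \<in> ?L S" using assms(1) by (auto simp: extensions_def bottoms_def)
  qed
  moreover have "finite {i. {i} \<in> bottoms S}"
    by (rule finite_subset[of _ "{1..n}"]) (use assms in \<open>auto simp: bottoms_def\<close>)
  moreover have "card ((#) i ` ?L (S - {i})) = card (?L (S - {i}))" for i
    by (rule card_image) simp
  moreover have "finite ((#) i ` ?L (S - {i}))" for i using fin by (rule finite_imageI)
  moreover have "(#) i ` ?L (S - {i}) \<inter> (#) j ` ?L (S - {j}) = {}" if "i \<noteq> j" for i j
    using that by auto
  ultimately show ?thesis by (simp only:) (subst card_UN_disjoint, simp_all)
qed

text \<open>The difference of consecutive counts is a sum over nonempty sets \<open>T\<close> of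
  minimal elements, with forms of degree \<open>card S - card T\<close>. Only singletons contribute
  to the top coefficient, which therefore obeys the recursion for linear extensions.\<close>

lemma binomial_form_strict_maps:
  assumes "S \<subseteq> {1..n}"
  shows "binomial_form (card S) (card {xs \<in> extensions. set xs = S})
    (\<lambda>k. real (card (strict_maps S k)))"
  using finite_subset[OF assms finite_atLeastAtMost] assms
proof (induction S rule: finite_psubset_induct)
  case (psubset S)
  let ?L = "\<lambda>S. {xs \<in> extensions. set xs = S}"
  show ?case
  proof (cases "S = {}")
    case True
    have "strict_maps {} k = {\<lambda>_. 0}" for k by (auto simp: strict_maps_def)
    moreover have "?L {} = {[]}" by (auto simp: extensions_def)
    ultimately show ?thesis using binomial_form_const[of 1] True by simp
  next
    case False
    define m where "m = card S - 1"
    have m: "card S = Suc m" using False psubset.hyps by (simp add: m_def card_gt_0_iff)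
    let ?B = "bottoms S - {{}}"
    \<comment> \<open>Removing more than one element drops below degree \<open>m\<close>, hence the
      coefficient 0.\<close>
    let ?l = "\<lambda>T. if card T = 1 then real (card (?L (S - T))) else 0"
    have "binomial_form m (\<Sum>T\<in>?B. ?l T) (\<lambda>k. \<Sum>T\<in>?B. real (card (strict_maps (S - T) k)))"
    proof (rule binomial_form_sum)
      fix T assume T: "T \<in> ?B"
      then have T: "T \<subseteq> S" "T \<noteq> {}" by (auto simp: bottoms_def)
      then have "finite T" using psubset.hyps finite_subset by blast
      then have card: "card (S - T) = card S - card T" "0 < card T"
        using T by (auto simp: card_Diff_subset card_gt_0_iff)
      have "S - T \<subset> S" "S - T \<subseteq> {1..n}" using T psubset.prems by auto
      note IH = psubset.IH[OF this]
      show "binomial_form m (?l T) (\<lambda>k. real (card (strict_maps (S - T) k)))"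
      proof (cases "card T = 1")
        case True
        then show ?thesis using IH card m by simp
      next
        case False
        then have "card (S - T) < m" using card m card_mono[OF psubset.hyps T(1)] by linarith
        with binomial_form_higher[OF IH] False show ?thesis by simp
      qed
    qed
    moreover have "real (card (strict_maps S (Suc k))) - real (card (strict_maps S k)) =
        (\<Sum>T\<in>?B. real (card (strict_maps (S - T) k)))" for k
    proof -
      \<comment> \<open>The term of the empty set is the count at \<open>k\<close> itself, which the
        difference cancels.\<close>
      have "{} \<in> bottoms S" by (simp add: bottoms_def)
      then show ?thesis unfolding card_strict_maps_Suc[OF psubset.hyps]
        by (simp add: sum.remove[OF finite_bottoms[OF psubset.hyps]])
    qed
    moreover have "(\<Sum>T\<in>?B. ?l T) = real (card (?L S))"
    proof -
      have "(\<Sum>T\<in>?B. ?l T) = (\<Sum>T\<in>(\<lambda>i. {i}) ` {i. {i} \<in> bottoms S}. ?l T)"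
        using finite_bottoms[OF psubset.hyps]
        by (intro sum.mono_neutral_right) (auto simp: card_1_singleton_iff)
      also have "\<dots> = (\<Sum>i | {i} \<in> bottoms S. real (card (?L (S - {i}))))"
        by (subst sum.reindex) auto
      finally show ?thesis by (simp add: card_extensions_rec[OF psubset.prems False])
    qed
    ultimately show ?thesis unfolding m by (intro binomial_form_difference) simp
  qed
qed

text \<open>Every cell has degree \<open>card S + (2 * n - card S)\<close>, so all subsets
  \<open>S\<close> contribute to the leading term.\<close>

lemma binomial_form_covers:
  "binomial_form (2 * n) (card extensions) (\<lambda>d. real (card (covers d)))"
proof -
  let ?L = "\<lambda>S. {xs \<in> extensions. set xs = S}"
  have cells: "(\<forall>d. finite (cells S d)) \<and>
      binomial_form (2 * n) (card (?L S)) (\<lambda>d. real (card (cells S d)))" if "S \<subseteq> {1..n}" for S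
  proof -
    have fin: "finite S" using that finite_subset by blast
    have "card (V n - Y ` S) = 2 * n - card S"
      using that fin by (subst card_Diff_subset) (auto simp: card_V card_image inj_on_def)
    moreover have "card S \<le> n" using card_mono[OF _ that] by simp
    ultimately have "card S + card (V n - Y ` S) = 2 * n" by simp
    moreover have "finite (V n - Y ` S)" using finite_V by simp
    ultimately show ?thesis
      using binomial_form_convolution[OF _ finite_strict_maps[OF fin] binomial_form_strict_maps[OF that],
        of "V n - Y ` S"] by (simp add: cells_def)
  qed
  have "binomial_form (2 * n) (\<Sum>S\<in>Pow {1..n}. real (card (?L S)))
      (\<lambda>d. \<Sum>S\<in>Pow {1..n}. real (card (cells S d)))"
    by (rule binomial_form_sum) (use cells in auto)
  moreover have "card extensions = (\<Sum>S\<in>Pow {1..n}. card (?L S))"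
  proof -
    have "extensions = (\<Union>S\<in>Pow {1..n}. ?L S)" by (auto simp: extensions_def)
    then have "card extensions = card (\<Union>S\<in>Pow {1..n}. ?L S)" by simp
    also have "\<dots> = (\<Sum>S\<in>Pow {1..n}. card (?L S))"
      using finite_extensions by (intro card_UN_disjoint) auto
    finally show ?thesis .
  qed
  moreover have "card (covers d) = (\<Sum>S\<in>Pow {1..n}. card (cells S d))" for d
    by (rule card_covers) (use cells in auto)
  ultimately show ?thesis by simp
qed

section \<open>Bounds for the number of extensions and their equality cases\<close>

lemma extension_exists:
  assumes "S \<subseteq> {1..n}"
  obtains xs where "xs \<in> extensions" "set xs = S"
proof
  have fin: "finite S" using assms finite_subset by blast
  then show "set (sorted_list_of_set S) = S" by simp
  have "sorted_wrt (<) (sorted_list_of_set S)" by simp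
  then have "sorted_wrt (\<lambda>a b. \<not> R b a) (sorted_list_of_set S)"
    by (rule sorted_wrt_mono_rel[rotated]) (use R_le in \<open>auto simp: not_le[symmetric]\<close>)
  then show "sorted_list_of_set S \<in> extensions" using assms fin by (simp add: extensions_def)
qed

lemma set_extensions: "set ` extensions = Pow {1..n}"
proof
  show "Pow {1..n} \<subseteq> set ` extensions"
    using extension_exists by (metis PowD image_eqI subsetI)
qed (auto simp: extensions_def)

lemma card_extensions_ge: "2 ^ n \<le> card extensions"
  using card_image_le[OF finite_extensions, of set] by (simp add: set_extensions card_Pow)

text \<open>Equality means that \<open>set\<close> is injective on \<open>extensions\<close>.
  Incomparable \<open>i\<close> and \<open>j\<close> give two lists with the same set. In a chain
  each extension is strictly increasing, hence determined by its set.\<close>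

lemma card_extensions_eq_lower:
  "card extensions = 2 ^ n \<longleftrightarrow> (\<forall>i\<in>{1..n}. \<forall>j\<in>{1..n}. R i j \<or> R j i)"
proof -
  have "card extensions = 2 ^ n \<longleftrightarrow> inj_on set extensions"
    using inj_on_iff_eq_card[OF finite_extensions, of set] by (auto simp: set_extensions card_Pow)
  also have "\<dots> \<longleftrightarrow> (\<forall>i\<in>{1..n}. \<forall>j\<in>{1..n}. R i j \<or> R j i)"
  proof (intro iffI ballI)
    fix i j assume inj: "inj_on set extensions" and ij: "i \<in> {1..n}" "j \<in> {1..n}"
    show "R i j \<or> R j i"
    proof (rule ccontr)
      assume "\<not> (R i j \<or> R j i)"
      then have "[i, j] \<in> extensions" "[j, i] \<in> extensions" "i \<noteq> j"
        using ij R_refl by (auto simp: extensions_def)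
      then show False using inj_onD[OF inj, of "[i, j]" "[j, i]"] by auto
    qed
  next
    assume total: "\<forall>i\<in>{1..n}. \<forall>j\<in>{1..n}. R i j \<or> R j i"
    have sorted: "sorted_wrt (<) xs" if "xs \<in> extensions" for xs
    proof (rule sorted_wrt_mono_rel)
      show "sorted_wrt (\<lambda>a b. \<not> R b a) xs" using that by (simp add: extensions_def)
      fix a b assume ab: "a \<in> set xs" "b \<in> set xs" "\<not> R b a"
      then have "a \<in> {1..n}" "b \<in> {1..n}" using that by (auto simp: extensions_def)
      with ab(3) total have "R a b" "a \<noteq> b" using R_refl by blast+
      then show "a < b" using R_le by (simp add: order.strict_iff_order)
    qed
    show "inj_on set extensions"
      by (rule inj_onI) (metis sorted strict_sorted_equal)
  qed
  finally show ?thesis .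
qed

end

text \<open>There are \<open>fact n / fact (n - l)\<close> distinct lists of length
  \<open>l\<close>; the sum is then reversed.\<close>

lemma card_distinct_lists:
  assumes "finite A"
  shows "real (card {xs. set xs \<subseteq> A \<and> distinct xs}) = fact (card A) * (\<Sum>l=0..card A. 1 / fact l)"
proof -
  define n where "n = card A"
  let ?D = "\<lambda>l. {xs. length xs = l \<and> distinct xs \<and> set xs \<subseteq> A}"
  have fin: "finite (?D l)" for l
    by (rule finite_subset[OF _ finite_subset_distinct[OF assms]]) auto
  have "{xs. set xs \<subseteq> A \<and> distinct xs} = (\<Union>l\<in>{0..n}. ?D l)"
    using card_mono[OF assms] by (auto simp: n_def simp flip: distinct_card)
  then have "card {xs. set xs \<subseteq> A \<and> distinct xs} = (\<Sum>l=0..n. card (?D l))"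
    by (simp only:) (rule card_UN_disjoint, use fin in auto)
  also have "real \<dots> = (\<Sum>l=0..n. fact n / fact (n - l))"
    unfolding of_nat_sum
  proof (rule sum.cong)
    fix l assume "l \<in> {0..n}"
    then have l: "l \<le> n" by simp
    have "card (?D l) = fact n div fact (n - l)"
      using l card_lists_distinct_length_eq[OF assms, of l] fact_div_fact[of "n - l" n]
      by (simp add: n_def)
    then have "fact (n - l) * card (?D l) = fact n"
      by (simp add: fact_dvd)
    then have "real (fact (n - l)) * real (card (?D l)) = fact n"
      by (metis of_nat_fact of_nat_mult)
    then show "real (card (?D l)) = fact n / fact (n - l)"
      by (simp add: field_simps)
  qed simp
  also have "\<dots> = (\<Sum>l=0..n. fact n / fact l)"
    by (rule sum.reindex_bij_witness[of _ "\<lambda>l. n - l" "\<lambda>l. n - l"]) auto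
  finally show ?thesis by (simp add: n_def sum_distrib_left)
qed

context natural_labelling
begin

text \<open>Extensions are distinct lists. A relation \<open>R i j\<close> with distinct
  \<open>i\<close> and \<open>j\<close> excludes the list \<open>[j, i]\<close>, so equality forces
  an antichain.\<close>

lemma card_extensions_le: "card extensions \<le> fact n * (\<Sum>l=0..n. 1 / fact l)"
  and card_extensions_eq_upper: "card extensions = fact n * (\<Sum>l=0..n. 1 / fact l) \<longleftrightarrow>
    (\<forall>i j. R i j \<longrightarrow> i = j)"
proof -
  let ?D = "{xs. set xs \<subseteq> {1..n} \<and> distinct xs}"
  have card: "real (card ?D) = fact n * (\<Sum>l=0..n. 1 / fact l)"
    using card_distinct_lists[of "{1..n}"] by simp
  have fin: "finite ?D" using finite_subset_distinct by blast
  have sub: "extensions \<subseteq> ?D" using distinct_extension by (auto simp: extensions_def)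
  from card_mono[OF fin sub] show "card extensions \<le> fact n * (\<Sum>l=0..n. 1 / fact l)"
    by (simp flip: card)
  have "card extensions = fact n * (\<Sum>l=0..n. 1 / fact l) \<longleftrightarrow> extensions = ?D"
    using card_subset_eq[OF fin sub] by (auto simp flip: card)
  also have "\<dots> \<longleftrightarrow> (\<forall>i j. R i j \<longrightarrow> i = j)"
  proof (intro iffI allI impI)
    fix i j assume eq: "extensions = ?D" and ij: "R i j"
    show "i = j"
    proof (rule ccontr)
      assume "i \<noteq> j"
      then have "[j, i] \<in> extensions" using R_carrier[OF ij] unfolding eq by auto
      then show False using ij by (simp add: extensions_def)
    qed
  next
    assume eq: "\<forall>i j. R i j \<longrightarrow> i = j"
    have "xs \<in> extensions" if xs: "xs \<in> ?D" for xs
    proof -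
      have "\<not> R (xs ! j) (xs ! i)" if "i < j" "j < length xs" for i j
        using that xs eq nth_eq_iff_index_eq[of xs j i] by auto
      then show ?thesis using xs by (simp add: extensions_def sorted_wrt_iff_nth_less)
    qed
    then show "extensions = ?D" using sub by blast
  qed
  finally show "card extensions = fact n * (\<Sum>l=0..n. 1 / fact l) \<longleftrightarrow> (\<forall>i j. R i j \<longrightarrow> i = j)" .
qed

end


section \<open>The multiplicity\<close>

text \<open>\<open>\<tau>\<close> takes the vertices of the poset graph back to those of
  \<open>E\<close>; it is the inverse of the relabelling.\<close>

locale labelled_poset_graph = natural_labelling +
  fixes \<tau> :: "vertex \<Rightarrow> vertex" and E :: "vertex set set"
  assumes bij: "bij_betw \<tau> (V n) (V n)"
    and E_eq: "E = {{\<tau> (X i), \<tau> (Y j)} | i j. R i j}"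
begin

lemma \<tau>_eq_iff: "u \<in> V n \<Longrightarrow> v \<in> V n \<Longrightarrow> \<tau> u = \<tau> v \<longleftrightarrow> u = v"
  using bij by (auto simp: bij_betw_def inj_on_def)

lemma \<tau>_in_V: "u \<in> V n \<Longrightarrow> \<tau> u \<in> V n"
  using bij by (auto simp: bij_betw_def)

lemma sum_\<tau>: "(\<Sum>u\<in>V n. f (\<tau> u)) = sum f (V n)"
  by (rule sum.reindex_bij_betw[OF bij])

lemma edge: "R i j \<Longrightarrow> {\<tau> (X i), \<tau> (Y j)} \<in> E"
  unfolding E_eq by (intro CollectI exI[of _ i] exI[of _ j]) simp

text \<open>For each \<open>i\<close> exactly one of the images of \<open>X i\<close> and
  \<open>Y i\<close> lies in \<open>C\<close>. Reflexivity gives at least one. If both did,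
  minimality would give edges from \<open>X i\<close> to some \<open>Y b\<close> and from some
  \<open>X c\<close> to \<open>Y i\<close> whose other ends are not in \<open>C\<close>; by
  transitivity the edge from \<open>X c\<close> to \<open>Y b\<close> would be uncovered.\<close>

lemma card_minimal_vertex_cover:
  assumes "minimal_vertex_cover n E C"
  shows "card C = n"
proof -
  have C: "C \<subseteq> V n" and meets: "\<forall>e\<in>E. e \<inter> C \<noteq> {}"
    using assms by (simp_all add: minimal_vertex_cover_def vertex_cover_def)
  have cover: "\<tau> (X i) \<in> C \<or> \<tau> (Y j) \<in> C" if "R i j" for i j
  proof -
    have "{\<tau> (X i), \<tau> (Y j)} \<inter> C \<noteq> {}" by (rule bspec[OF meets edge[OF that]])
    then show ?thesis by auto
  qed
  \<comment> \<open>Removing \<open>v\<close> from a minimal cover uncovers some edge, which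
    \<open>C\<close> thus meets in \<open>v\<close> only.\<close>
  have critical: "\<exists>i j. R i j \<and> {\<tau> (X i), \<tau> (Y j)} \<inter> C = {v}" if "v \<in> C" for v
  proof -
    have "\<not> vertex_cover n E (C - {v})"
      using assms that unfolding minimal_vertex_cover_def by blast
    then obtain i j where ij: "R i j" "{\<tau> (X i), \<tau> (Y j)} \<inter> (C - {v}) = {}"
      using C by (auto simp: vertex_cover_def E_eq)
    with cover[OF ij(1)] show ?thesis by (intro exI[of _ i] exI[of _ j]) auto
  qed
  have one: "of_bool (\<tau> (X i) \<in> C) + of_bool (\<tau> (Y i) \<in> C) = (1 :: nat)" if i: "i \<in> {1..n}" for i
  proof -
    have "\<not> (\<tau> (X i) \<in> C \<and> \<tau> (Y i) \<in> C)"
    proof safe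
      assume *: "\<tau> (X i) \<in> C" "\<tau> (Y i) \<in> C"
      obtain a b where ab: "R a b" "{\<tau> (X a), \<tau> (Y b)} \<inter> C = {\<tau> (X i)}"
        using critical[OF *(1)] by blast
      obtain c d where cd: "R c d" "{\<tau> (X c), \<tau> (Y d)} \<inter> C = {\<tau> (Y i)}"
        using critical[OF *(2)] by blast
      have V: "X a \<in> V n" "Y b \<in> V n" "X c \<in> V n" "Y d \<in> V n" "X i \<in> V n" "Y i \<in> V n"
        using R_carrier[OF ab(1)] R_carrier[OF cd(1)] i by auto
      have only: "b \<notin> C \<and> a = v" if "{a, b} \<inter> C = {v}" "b \<noteq> v" for a b v
      proof -
        have "v \<in> {a, b} \<inter> C" by (simp only: that(1) singletonI)
        then have "a = v" using that(2) by auto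
        moreover have "b \<notin> {a, b} \<inter> C" using that(2) by (simp only: that(1) singleton_iff) simp
        ultimately show ?thesis by simp
      qed
      have "\<tau> (Y b) \<notin> C \<and> \<tau> (X a) = \<tau> (X i)"
        using \<tau>_eq_iff[OF V(2,5)] by (intro only[OF ab(2)]) simp
      then have b: "\<tau> (Y b) \<notin> C" "a = i" using \<tau>_eq_iff[OF V(1,5)] by auto
      have "\<tau> (X c) \<notin> C \<and> \<tau> (Y d) = \<tau> (Y i)"
        using cd(2) \<tau>_eq_iff[OF V(3,6)] by (intro only) (simp_all add: insert_commute)
      then have c: "\<tau> (X c) \<notin> C" "d = i" using \<tau>_eq_iff[OF V(4,6)] by auto
      have "R c b" using R_trans[of c i b] ab(1) cd(1) b(2) c(2) by simp
      from cover[OF this] show False using b(1) c(1) by simp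
    qed
    with cover[OF R_refl[OF i]] show ?thesis by auto
  qed
  have "card C = (\<Sum>u\<in>V n. of_bool (u \<in> C))"
    using C finite_V by (simp add: Int_absorb1 of_bool_def flip: sum.inter_restrict)
  also have "\<dots> = (\<Sum>u\<in>V n. of_bool (\<tau> u \<in> C))"
    by (rule sum_\<tau>[symmetric])
  also have "\<dots> = (\<Sum>i\<in>{1..n}. 1)" unfolding sum_V by (rule sum.cong) (simp_all only: one)
  finally show ?thesis by simp
qed

lemma vertex_cover_vector_iff:
  "vertex_cover_vector n E k c \<longleftrightarrow> Poly_Mapping.keys c \<subseteq> V n \<and>
    (\<forall>i j. R i j \<longrightarrow> k \<le> Poly_Mapping.lookup c (\<tau> (X i)) + Poly_Mapping.lookup c (\<tau> (Y j)))"
proof -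
  let ?l = "Poly_Mapping.lookup c"
  have "(\<forall>v w. {v, w} \<in> E \<longrightarrow> k \<le> ?l v + ?l w) \<longleftrightarrow>
      (\<forall>i j. R i j \<longrightarrow> k \<le> ?l (\<tau> (X i)) + ?l (\<tau> (Y j)))"
  proof (intro iffI allI impI)
    fix i j assume cover: "\<forall>v w. {v, w} \<in> E \<longrightarrow> k \<le> ?l v + ?l w" and "R i j"
    then have "{\<tau> (X i), \<tau> (Y j)} \<in> E" by (simp add: edge)
    with cover show "k \<le> ?l (\<tau> (X i)) + ?l (\<tau> (Y j))" by simp
  next
    fix v w assume *: "\<forall>i j. R i j \<longrightarrow> k \<le> ?l (\<tau> (X i)) + ?l (\<tau> (Y j))" and "{v, w} \<in> E"
    from this(2) obtain i j where "R i j" "{v, w} = {\<tau> (X i), \<tau> (Y j)}"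
      unfolding E_eq by (elim CollectE exE conjE)
    moreover from this(2) have "v = \<tau> (X i) \<and> w = \<tau> (Y j) \<or> v = \<tau> (Y j) \<and> w = \<tau> (X i)"
      by (simp add: doubleton_eq_iff)
    ultimately show "k \<le> ?l v + ?l w" using * by (auto simp: add.commute)
  qed
  then show ?thesis by (simp add: vertex_cover_vector_def)
qed

text \<open>Composition with \<open>\<tau>\<close> undoes the relabelling and turns polynomial
  mappings into plain functions that vanish off \<open>V n\<close>.\<close>

lemma card_cover_exponents: "card (cover_exponents n E d) = card (covers d)"
proof -
  define F where "F = (\<lambda>(c, k :: nat). (\<lambda>u. if u \<in> V n then Poly_Mapping.lookup c (\<tau> u) else (0 :: nat), k))"
  have "(c, k) \<in> cover_exponents n E d \<longleftrightarrow> Poly_Mapping.keys c \<subseteq> V n \<and> F (c, k) \<in> covers d" for c k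
  proof -
    have "(\<Sum>u\<in>V n. Poly_Mapping.lookup c (\<tau> u)) = (\<Sum>u\<in>V n. Poly_Mapping.lookup c u)"
      by (rule sum_\<tau>)
    then show ?thesis
      using R_carrier
      by (auto simp: F_def cover_exponents_def covers_def vertex_cover_vector_iff)
  qed
  then have mem: "x \<in> cover_exponents n E d \<longleftrightarrow> Poly_Mapping.keys (fst x) \<subseteq> V n \<and> F x \<in> covers d" for x
    by (cases x) auto
  have "bij_betw F (cover_exponents n E d) (covers d)"
    unfolding bij_betw_def
  proof
    show "inj_on F (cover_exponents n E d)"
    proof (rule inj_onI)
      fix x y assume *: "x \<in> cover_exponents n E d" "y \<in> cover_exponents n E d" "F x = F y"
      obtain c k c' k' where xy: "x = (c, k)" "y = (c', k')" by (cases x, cases y)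
      have "Poly_Mapping.lookup c v = Poly_Mapping.lookup c' v" for v
      proof (cases "v \<in> V n")
        case True
        then obtain u where "u \<in> V n" "v = \<tau> u" using bij by (auto simp: bij_betw_def)
        then show ?thesis using *(3) by (auto simp: xy F_def dest: fun_cong[of _ _ u])
      next
        case False
        then show ?thesis using * mem[of x] mem[of y]
          by (metis fst_conv in_keys_iff subsetD xy)
      qed
      then have "c = c'" by (rule poly_mapping_eqI)
      then show "x = y" using *(3) by (simp add: xy F_def)
    qed
    show "F ` cover_exponents n E d = covers d"
    proof (intro equalityI subsetI)
      fix y assume y: "y \<in> covers d"
      obtain f k where fk: "y = (f, k)" by (cases y)
      define h where "h v = (if v \<in> V n then f (inv_into (V n) \<tau> v) else 0)" for v
      have "finite {v. h v \<noteq> 0}" by (rule finite_subset[OF _ finite_V[of n]]) (auto simp: h_def)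
      then have lookup: "Poly_Mapping.lookup (Abs_poly_mapping h) = h"
        by (simp add: Abs_poly_mapping_inverse)
      have "inv_into (V n) \<tau> (\<tau> u) = u" if "u \<in> V n" for u
        using bij that by (simp add: bij_betw_def)
      then have "F (Abs_poly_mapping h, k) = y"
        using y by (auto simp: F_def fk lookup h_def \<tau>_in_V covers_def fun_eq_iff)
      moreover have "Poly_Mapping.keys (Abs_poly_mapping h) \<subseteq> V n"
        by (auto simp: in_keys_iff lookup h_def split: if_splits)
      ultimately have "(Abs_poly_mapping h, k) \<in> cover_exponents n E d" using y by (simp add: mem)
      with \<open>F (Abs_poly_mapping h, k) = y\<close> show "y \<in> F ` cover_exponents n E d" by blast
    qed (use mem in auto)
  qed
  then show ?thesis by (rule bij_betw_same_card)
qed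

text \<open>The number of extensions is positive, so it is the true leading coefficient and the
  factor \<open>fact (2 * n)\<close> cancels.\<close>

lemma multiplicity_vca_eq:
  assumes "bipartite_graph n E"
  shows "multiplicity_vca TYPE('k::field) n E = card extensions"
proof -
  have "card extensions > 0" using card_extensions_ge by (rule less_le_trans[rotated]) simp
  moreover have "binomial_form (2 * n) (card extensions)
      (\<lambda>d. real (hilbert_function (vertex_cover_algebra n E :: 'k polyS poly set)
        (degree_one_generators n E) d))"
    using binomial_form_covers
    by (simp add: hilbert_function_vertex_cover_algebra[OF assms card_minimal_vertex_cover]
        card_cover_exponents)
  ultimately show ?thesis
    by (simp add: multiplicity_vca_def lead_coeff_hilbert_polynomial)
qed

end

theorem corollary3p13:
  fixes n :: nat and E :: "vertex set set" and P :: "'a set" and r :: "'a rel"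
  assumes "n \<ge> 1"
    and "bipartite_graph n E"
    and "comes_from_poset n E P r"
  shows "2 ^ n \<le> multiplicity_vca TYPE('k::field) n E \<and>
         multiplicity_vca TYPE('k) n E \<le> fact n * (\<Sum>l=0..n. 1 / fact l) \<and>
         (multiplicity_vca TYPE('k) n E = 2 ^ n \<longleftrightarrow> linear_order_on P r) \<and>
         (multiplicity_vca TYPE('k) n E = fact n * (\<Sum>l=0..n. 1 / fact l) \<longleftrightarrow> antichain P r)"
proof -
  obtain p \<sigma> where po: "partial_order_on P r" and p: "bij_betw p {1..n} P"
    and label: "\<forall>i\<in>{1..n}. \<forall>j\<in>{1..n}. (p i, p j) \<in> r \<longrightarrow> i \<le> j"
    and \<sigma>: "bij_betw \<sigma> (V n) (V n)" "(\<lambda>e. \<sigma> ` e) ` E = poset_graph n p r"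
    using assms(3) unfolding comes_from_poset_def by (elim conjE exE) (rule that)
  define R where "R i j \<longleftrightarrow> i \<in> {1..n} \<and> j \<in> {1..n} \<and> (p i, p j) \<in> r" for i j
  have P: "P = p ` {1..n}" "inj_on p {1..n}" using p by (auto simp: bij_betw_def)
  have P_refl: "\<And>a. a \<in> P \<Longrightarrow> (a, a) \<in> r" and trans: "trans r"
    using po by (auto simp: partial_order_on_def preorder_on_def refl_on_def)
  let ?\<tau> = "inv_into (V n) \<sigma>"
  obtain A B where AB: "A \<union> B = V n" "\<forall>e\<in>E. \<exists>v\<in>A. \<exists>w\<in>B. e = {v, w}"
    using assms(2) unfolding bipartite_graph_def by (elim exE conjE) (rule that)
  \<comment> \<open>The hypothesis on \<open>\<sigma>\<close> only concerns images of edges.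
    Bipartiteness places the edges inside \<open>V n\<close>, where \<open>\<sigma>\<close> can be
    inverted.\<close>
  have inv_image: "?\<tau> ` \<sigma> ` e = e" if "e \<in> E" for e
  proof -
    have "e \<subseteq> V n" using bspec[OF AB(2) that] AB(1) by auto
    then show ?thesis using \<sigma>(1) by (simp add: bij_betw_def inv_into_image_cancel)
  qed
  have "E = (\<lambda>e. ?\<tau> ` \<sigma> ` e) ` E" using inv_image by simp
  also have "\<dots> = (\<lambda>e. ?\<tau> ` e) ` poset_graph n p r"
    by (simp only: image_image flip: \<sigma>(2))
  also have "\<dots> = {{?\<tau> (X i), ?\<tau> (Y j)} | i j. R i j}" (is "?L = ?R")
  proof (intro equalityI subsetI)
    fix e assume "e \<in> ?L"
    then obtain i j where "R i j" "e = ?\<tau> ` {X i, Y j}"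
      unfolding poset_graph_def R_def by blast
    then show "e \<in> ?R" by (intro CollectI exI[of _ i] exI[of _ j]) simp
  next
    fix e assume "e \<in> ?R"
    then obtain i j where ij: "R i j" "e = {?\<tau> (X i), ?\<tau> (Y j)}" by (elim CollectE exE conjE)
    then have "{X i, Y j} \<in> poset_graph n p r"
      unfolding poset_graph_def R_def by blast
    then show "e \<in> ?L" by (rule rev_image_eqI) (simp add: ij)
  qed
  finally have E: "E = {{?\<tau> (X i), ?\<tau> (Y j)} | i j. R i j}" .
  interpret labelled_poset_graph n R ?\<tau> E
  proof
    show "i \<in> {1..n} \<and> j \<in> {1..n}" "i \<le> j" if "R i j" for i j
      using that label unfolding R_def by blast+
    show "R i i" if "i \<in> {1..n}" for i
      using that P_refl unfolding R_def P(1) by blast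
    show "R i k" if "R i j" "R j k" for i j k
      using that transD[OF trans] unfolding R_def by blast
    show "bij_betw ?\<tau> (V n) (V n)" by (rule bij_betw_inv_into[OF \<sigma>(1)])
    show "E = {{?\<tau> (X i), ?\<tau> (Y j)} | i j. R i j}" by (rule E)
  qed
  have "linear_order_on P r \<longleftrightarrow> (\<forall>a\<in>P. \<forall>b\<in>P. (a, b) \<in> r \<or> (b, a) \<in> r)"
    unfolding linear_order_on_def total_on_def using po P_refl by metis
  also have "\<dots> \<longleftrightarrow> (\<forall>i\<in>{1..n}. \<forall>j\<in>{1..n}. R i j \<or> R j i)"
    unfolding P(1) ball_simps(9) R_def by auto
  finally have chain: "linear_order_on P r \<longleftrightarrow> (\<forall>i\<in>{1..n}. \<forall>j\<in>{1..n}. R i j \<or> R j i)" .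
  have "antichain P r \<longleftrightarrow> (\<forall>i\<in>{1..n}. \<forall>j\<in>{1..n}. (p i, p j) \<in> r \<longrightarrow> p i = p j)"
    unfolding antichain_def P(1) ball_simps(9) ..
  also have "\<dots> \<longleftrightarrow> (\<forall>i\<in>{1..n}. \<forall>j\<in>{1..n}. (p i, p j) \<in> r \<longrightarrow> i = j)"
    by (intro ball_cong refl) (simp add: inj_on_eq_iff[OF P(2)])
  also have "\<dots> \<longleftrightarrow> (\<forall>i j. R i j \<longrightarrow> i = j)"
    unfolding R_def by blast
  finally have anti: "antichain P r \<longleftrightarrow> (\<forall>i j. R i j \<longrightarrow> i = j)" .
  \<comment> \<open>The lower bound and its equality case were proved over the naturals and are
    moved to the reals.\<close>
  have "real (card extensions) = 2 ^ n \<longleftrightarrow> card extensions = 2 ^ n"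
    using of_nat_eq_iff[of "card extensions" "2 ^ n", where 'a = real] by simp
  moreover have "2 ^ n \<le> real (card extensions)"
    using of_nat_mono[OF card_extensions_ge, where 'a = real] by simp
  ultimately show ?thesis
    using card_extensions_le card_extensions_eq_upper card_extensions_eq_lower
    by (simp add: multiplicity_vca_eq[OF assms(2)] chain anti)
qed

end
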